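(* Let $n\ge 3$ and $q\ge 1$ be integers, and let $C_n$ be the cycle graph. For every tuple of non-negative integers $\mathbf{m}=(m_1,\dots,m_n)$, with $m_{n+1}:=m_1$, the coefficient of $\mathbf{x}^{\mathbf{m}}$ in $I(C_n,\mathbf{x})^{-q}$ is $$I(C_n,\mathbf{x})^{-q}[\mathbf{x}^{\mathbf{m}}]=\pi_{C_n}^{\mathbf{m}}(-q)=\frac{1}{\prod_{i=1}^n m_i!}\left(\prod_{i=1}^{n}(-q)_{(m_i+m_{i+1})}\right)\left(\sum_{k=0}^{\min_i m_i}(-1)^{kn}v_k(-q)\prod_{i=1}^n\frac{(m_i)_{(k)}}{(-q)_{(m_i+k)}}\right).$$ In particular, for $q=1$ and $\mathbf{a}=(a,\dots,a)$ with $a\ge 0$ an integer, $$I(C_n,\mathbf{x})^{-1}[\mathbf{x}^{\mathbf{a}}]=(-1)^{na}\sum_{|k|\le a}(-1)^k\binom{2a}{a+k}^n,$$ where the sum is over integers $k$ with $-a\le k\le a$.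
   Context: $C_n$ has vertices $1,\dots,n$ with $i$ joined to $i+1$ (indices modulo $n$). For a finite simple graph $\mathcal{G}$ with vertex set $I=\{1,\dots,n\}$, the multi-variate independence polynomial is $I(\mathcal{G},\mathbf{x})=\sum_{S}\prod_{i\in S}x_i\in\mathbb{Q}[[x_i : i\in I]]$, the sum being over all independent subsets $S\subseteq I$ (including $\emptyset$); it has constant term $1$ and hence is invertible. For a power series $f$, $f[\mathbf{x}^{\mathbf{m}}]$ denotes the coefficient of $\mathbf{x}^{\mathbf{m}}=\prod_i x_i^{m_i}$ in $f$. The generalized chromatic polynomial $\pi_{\mathcal{G}}^{\mathbf{m}}(q)$ is the polynomial in $q$ which, for every $q\in\mathbb{N}$, counts the maps $\tau$ from $I$ to the power set of $\{1,\dots,q\}$ with $|\tau(i)|=m_i$ for all $i\in I$ and $\tau(i)\cap\tau(j)=\emptyset$ whenever $i$ and $j$ are adjacent; it is evaluated at negative integers as a polynomial. Notation: $(z)_{(k)}=z(z-1)\cdots(z-k+1)$ is the falling factorial (with $(z)_{(0)}=1$), $\binom{z}{k}=(z)_{(k)}/k!$ for $k\geq 0$, $\binom{z}{-1}=0$, and $v_k(z)=\binom{z}{k}-\binom{z}{k-1}$. *)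

theory Defs
  imports
    "HOL-Library.Poly_Mapping"
    "HOL-Library.FuncSet"
    "HOL-Computational_Algebra.Polynomial"
    "Graph_Theory.Pair_Digraph"
begin

section \<open>Multivariate formal power series\<close>

text \<open>
  An exponent is a finitely supported function \<open>'i \<Rightarrow>\<^sub>0 nat\<close>, and a power series assigns a
  coefficient to every exponent. When \<open>'i\<close> is infinite, the series in which only the variables
  indexed by a finite set \<open>I\<close> occur form a copy of the power series ring over \<open>I\<close> inside this ring;
  the copy is closed under all ring operations and under \<open>inverse\<close>.
\<close>

typedef ('i, 'a) mfps = "UNIV :: (('i \<Rightarrow>\<^sub>0 nat) \<Rightarrow> 'a) set"
  morphisms mfps_coeff Abs_mfps ..

lemma mfps_coeff_Abs [simp]: "mfps_coeff (Abs_mfps f) = f"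
  by (simp add: Abs_mfps_inverse)

lemma mfps_eqI: "(\<And>m. mfps_coeff f m = mfps_coeff g m) \<Longrightarrow> f = g"
  by (metis ext mfps_coeff_inverse)

definition splits :: "('i \<Rightarrow>\<^sub>0 nat) \<Rightarrow> (('i \<Rightarrow>\<^sub>0 nat) \<times> ('i \<Rightarrow>\<^sub>0 nat)) set" where
  "splits m = {(a, b). a + b = m}"

lemma finite_splits [simp]:
  fixes m :: "'i \<Rightarrow>\<^sub>0 nat"
  shows "finite (splits m)"
proof -
  define F where
    "F = (\<lambda>f :: 'i \<Rightarrow> nat. Abs_poly_mapping (\<lambda>i. if i \<in> Poly_Mapping.keys m then f i else 0))"
  have "fst ` splits m \<subseteq> F ` (\<Pi>\<^sub>E i\<in>Poly_Mapping.keys m. {..Poly_Mapping.lookup m i})"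
  proof
    fix a assume "a \<in> fst ` splits m"
    then obtain b where b: "a + b = m" by (auto simp: splits_def)
    define f where "f = restrict (Poly_Mapping.lookup a) (Poly_Mapping.keys m)"
    have "f \<in> (\<Pi>\<^sub>E i\<in>Poly_Mapping.keys m. {..Poly_Mapping.lookup m i})"
      by (auto simp: f_def b[symmetric] lookup_add)
    moreover have "(\<lambda>i. if i \<in> Poly_Mapping.keys m then f i else 0) = Poly_Mapping.lookup a"
      using b by (auto simp: f_def fun_eq_iff in_keys_iff lookup_add)
    hence "a = F f" by (simp add: F_def)
    ultimately show "a \<in> F ` (\<Pi>\<^sub>E i\<in>Poly_Mapping.keys m. {..Poly_Mapping.lookup m i})" by blast
  qed
  moreover have "finite (\<Pi>\<^sub>E i\<in>Poly_Mapping.keys m. {..Poly_Mapping.lookup m i})" by (intro finite_PiE) auto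
  ultimately have "finite (fst ` splits m)" by (meson finite_imageI finite_subset)
  moreover have "inj_on fst (splits m)" by (auto simp: inj_on_def splits_def)
  ultimately show ?thesis by (rule finite_imageD)
qed

instantiation mfps :: (type, comm_ring_1) comm_ring_1
begin

definition "0 = Abs_mfps (\<lambda>_. 0)"
definition "1 = Abs_mfps (\<lambda>m. if m = 0 then 1 else 0)"
definition "f + g = Abs_mfps (\<lambda>m. mfps_coeff f m + mfps_coeff g m)"
definition "- f = Abs_mfps (\<lambda>m. - mfps_coeff f m)"
definition "f - g = Abs_mfps (\<lambda>m. mfps_coeff f m - mfps_coeff g m)"
definition "f * g = Abs_mfps (\<lambda>m. \<Sum>(a, b)\<in>splits m. mfps_coeff f a * mfps_coeff g b)"

lemma mfps_coeff_simps [simp]: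
  "mfps_coeff (0 :: ('a, 'b) mfps) m = 0"
  "mfps_coeff (f + g :: ('a, 'b) mfps) m = mfps_coeff f m + mfps_coeff g m"
  "mfps_coeff (- f) m = - mfps_coeff f m"
  "mfps_coeff (f - g) m = mfps_coeff f m - mfps_coeff g m"
  by (simp_all add: zero_mfps_def plus_mfps_def uminus_mfps_def minus_mfps_def)

lemma mfps_coeff_one: "mfps_coeff (1 :: ('a, 'b) mfps) m = (if m = 0 then 1 else 0)"
  by (simp add: one_mfps_def)

lemma mfps_coeff_mult:
  "mfps_coeff (f * g :: ('a, 'b) mfps) m =
     (\<Sum>(a, b)\<in>splits m. mfps_coeff f a * mfps_coeff g b)"
  by (simp add: times_mfps_def)

instance
proof
  fix f g h :: "('a, 'b) mfps"
  show "f * g * h = f * (g * h)"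
  proof (rule mfps_eqI)
    fix m
    have "mfps_coeff (f * g * h) m =
      (\<Sum>(x, y)\<in>Sigma (splits m) (\<lambda>x. splits (fst x)).
         mfps_coeff f (fst y) * mfps_coeff g (snd y) * mfps_coeff h (snd x))"
      by (simp add: mfps_coeff_mult sum_distrib_right case_prod_unfold sum.Sigma)
    also have "\<dots> = (\<Sum>(x, y)\<in>Sigma (splits m) (\<lambda>x. splits (snd x)).
         mfps_coeff f (fst x) * (mfps_coeff g (fst y) * mfps_coeff h (snd y)))"
      by (rule sum.reindex_bij_witness
            [where i = "\<lambda>((a, b), (c, d)). ((a + c, d), (a, c))"
               and j = "\<lambda>((a, b), (c, d)). ((c, d + b), (d, b))"])
         (auto simp: splits_def algebra_simps)
    also have "\<dots> = mfps_coeff (f * (g * h)) m"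
      by (simp add: mfps_coeff_mult sum_distrib_left case_prod_unfold sum.Sigma)
    finally show "mfps_coeff (f * g * h) m = mfps_coeff (f * (g * h)) m" .
  qed
  show "f * g = g * f"
  proof (rule mfps_eqI)
    fix m
    show "mfps_coeff (f * g) m = mfps_coeff (g * f) m"
      unfolding mfps_coeff_mult
      by (rule sum.reindex_bij_witness[where i = prod.swap and j = prod.swap])
         (auto simp: splits_def algebra_simps)
  qed
  show "1 * f = f"
  proof (rule mfps_eqI)
    fix m
    have "mfps_coeff (1 * f) m = (\<Sum>(a, b)\<in>{(0, m)}. mfps_coeff 1 a * mfps_coeff f b)"
      unfolding mfps_coeff_mult
      proof (rule sum.mono_neutral_right)
      show "finite (splits m)" by (fact finite_splits)
    qed (auto simp: splits_def mfps_coeff_one split: if_splits)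
    thus "mfps_coeff (1 * f) m = mfps_coeff f m" by (simp add: mfps_coeff_one)
  qed
  show "(f + g) * h = f * h + g * h"
    by (rule mfps_eqI)
       (simp add: mfps_coeff_mult case_prod_unfold algebra_simps sum.distrib)
  show "(0 :: ('a, 'b) mfps) \<noteq> 1"
    by (metis mfps_coeff_one mfps_coeff_simps(1) zero_neq_one)
qed (auto intro!: mfps_eqI simp: algebra_simps)

end

instantiation mfps :: (type, field) inverse
begin

definition inverse_mfps :: "('a, 'b) mfps \<Rightarrow> ('a, 'b) mfps" where
  "inverse f = (if mfps_coeff f 0 = 0 then 0 else (THE g. f * g = 1))"

definition "f div g = f * inverse (g :: ('a, 'b) mfps)"

instance ..

end

lemma mfps_coeff_sum [simp]: "mfps_coeff (sum f A) m = (\<Sum>x\<in>A. mfps_coeff (f x) m)"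
  by (induction A rule: infinite_finite_induct) auto

definition total_deg :: "('i \<Rightarrow>\<^sub>0 nat) \<Rightarrow> nat" where
  "total_deg m = (\<Sum>i\<in>Poly_Mapping.keys m. Poly_Mapping.lookup m i)"

lemma total_deg_add: "total_deg (a + b) = total_deg a + total_deg b"
proof -
  have *: "total_deg c = (\<Sum>i\<in>Poly_Mapping.keys a \<union> Poly_Mapping.keys b. Poly_Mapping.lookup c i)"
    if "Poly_Mapping.keys c \<subseteq> Poly_Mapping.keys a \<union> Poly_Mapping.keys b" for c
    unfolding total_deg_def using that
    by (intro sum.mono_neutral_left) (auto simp: in_keys_iff)
  show ?thesis
    using *[of a] *[of b] *[of "a + b"] keys_add[of a b]
    by (simp add: lookup_add sum.distrib)
qed

lemma total_deg_pos: "a \<noteq> 0 \<Longrightarrow> total_deg a > 0"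
  unfolding total_deg_def by (rule sum_pos) (auto simp: in_keys_iff)

lemma mfps_coeff_power_eq_0:
  assumes "mfps_coeff h 0 = 0" "total_deg m < k"
  shows "mfps_coeff (h ^ k) m = 0"
  using assms(2)
proof (induction k arbitrary: m)
  case (Suc k)
  have "mfps_coeff h a * mfps_coeff (h ^ k) b = 0" if "a + b = m" for a b
  proof (cases "a = 0")
    case False
    thus ?thesis using Suc that total_deg_pos[of a] total_deg_add[of a b] by auto
  qed (use assms in auto)
  thus ?case by (auto simp: mfps_coeff_mult splits_def intro!: sum.neutral)
qed simp

lemma mfps_right_inverse:
  fixes f :: "('i, 'a :: field) mfps"
  assumes "mfps_coeff f 0 \<noteq> 0"
  shows "f * inverse f = 1"
proof -
  define c where "c = (Abs_mfps (\<lambda>m. if m = 0 then inverse (mfps_coeff f 0) else 0) :: ('i, 'a) mfps)"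
  define h where "h = 1 - c * f"
  have "splits (0 :: 'i \<Rightarrow>\<^sub>0 nat) = {(0, 0)}"
  proof -
    have *: "a = 0 \<and> b = 0" if "a + b = 0" for a b :: "'i \<Rightarrow>\<^sub>0 nat"
      using that total_deg_add[of a b] total_deg_pos[of a] total_deg_pos[of b]
      by (auto simp: total_deg_def)
    show ?thesis
    proof (rule set_eqI)
      fix x :: "('i \<Rightarrow>\<^sub>0 nat) \<times> ('i \<Rightarrow>\<^sub>0 nat)"
      show "x \<in> splits 0 \<longleftrightarrow> x \<in> {(0, 0)}"
        using *[of "fst x" "snd x"] by (cases x) (auto simp: splits_def)
    qed
  qed
  hence h0: "mfps_coeff h 0 = 0"
    using assms by (simp add: h_def c_def mfps_coeff_mult mfps_coeff_one)
  define g where "g = Abs_mfps (\<lambda>m. \<Sum>k\<le>total_deg m. mfps_coeff (h ^ k) m)"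
  have g: "mfps_coeff g m = mfps_coeff (\<Sum>k\<le>N. h ^ k) m" if "total_deg m \<le> N" for m N
    unfolding g_def using that
    by (auto intro!: sum.mono_neutral_left) (meson mfps_coeff_power_eq_0[OF h0] not_le)
  have "(1 - h) * g = 1"
  proof (rule mfps_eqI)
    fix m :: "'i \<Rightarrow>\<^sub>0 nat"
    define N where "N = total_deg m"
    have "mfps_coeff ((1 - h) * g) m = mfps_coeff ((1 - h) * (\<Sum>k\<le>N. h ^ k)) m"
      unfolding mfps_coeff_mult
    proof (intro sum.cong refl, clarify)
      fix a b assume "(a, b) \<in> splits m"
      hence "total_deg b \<le> N" by (auto simp: splits_def N_def total_deg_add)
      thus "mfps_coeff (1 - h) a * mfps_coeff g b =
            mfps_coeff (1 - h) a * mfps_coeff (\<Sum>k\<le>N. h ^ k) b"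
        using g by simp
    qed
    also have "(1 - h) * (\<Sum>k\<le>N. h ^ k) = 1 - h ^ Suc N"
      by (simp only: sum_gp_basic)
    also have "mfps_coeff (1 - h ^ Suc N) m = mfps_coeff 1 m"
      unfolding N_def mfps_coeff_simps by (simp only: mfps_coeff_power_eq_0[OF h0]) simp
    finally show "mfps_coeff ((1 - h) * g) m = mfps_coeff 1 m" .
  qed
  hence *: "f * (c * g) = 1" by (simp add: h_def algebra_simps)
  have "\<exists>!g'. f * g' = 1"
  proof (rule ex1I)
    show "f * (c * g) = 1" by (fact *)
    fix g' assume g': "f * g' = 1"
    have "g' = f * (c * g) * g'" by (simp only: * mult_1_left)
    also have "\<dots> = c * g * (f * g')" by (simp only: mult_ac)
    finally show "g' = c * g" by (simp only: g' mult_1_right)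
  qed
  from theI'[OF this] show ?thesis using assms by (simp add: inverse_mfps_def)
qed

definition mfps_var :: "'i \<Rightarrow> ('i, 'a :: comm_ring_1) mfps" where
  "mfps_var i = Abs_mfps (\<lambda>m. if m = Poly_Mapping.single i 1 then 1 else 0)"

definition exponent :: "'i set \<Rightarrow> ('i \<Rightarrow> nat) \<Rightarrow> ('i \<Rightarrow>\<^sub>0 nat)" where
  "exponent I m = (\<Sum>i\<in>I. Poly_Mapping.single i (m i))"

lemma lookup_exponent:
  "finite I \<Longrightarrow> Poly_Mapping.lookup (exponent I m) i = (if i \<in> I then m i else 0)"
  unfolding exponent_def
  by (induction I rule: finite_induct) (auto simp: lookup_add lookup_single when_def)


section \<open>Graphs\<close>

text \<open>
  Finite simple graphs are modelled as in \<^locale>\<open>pair_graph\<close>: an undirected edge is a pair of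
  opposite arcs.
\<close>

definition cycle_graph :: "nat \<Rightarrow> nat pair_pre_digraph" where
  "cycle_graph n =
     \<lparr>pverts = {1..n},
      parcs = {(i, j). i \<in> {1..n} \<and> j \<in> {1..n} \<and> (j = i mod n + 1 \<or> i = j mod n + 1)}\<rparr>"

lemma pair_graph_cycle_graph:
  assumes "n \<ge> 3"
  shows "pair_graph (cycle_graph n)"
proof
  show "finite (parcs (cycle_graph n))"
    by (rule finite_subset[of _ "{1..n} \<times> {1..n}"]) (auto simp: cycle_graph_def)
  show "symmetric (with_proj (cycle_graph n))"
    by (auto simp: symmetric_def cycle_graph_def intro!: symI)
  have ne: "i mod n + 1 \<noteq> i" if "i \<in> {1..n}" for i
    using that assms by (cases "i = n") auto
  fix e assume "e \<in> parcs (cycle_graph n)"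
  thus "fst e \<noteq> snd e"
    using ne[of "fst e"] ne[of "snd e"]
    by (simp add: cycle_graph_def case_prod_beta del: atLeastAtMost_iff) metis
qed (auto simp: cycle_graph_def)

definition independent_sets :: "'i pair_pre_digraph \<Rightarrow> 'i set set" where
  "independent_sets G = {S. S \<subseteq> pverts G \<and> (\<forall>i\<in>S. \<forall>j\<in>S. (i, j) \<notin> parcs G)}"

definition independence_series :: "'i pair_pre_digraph \<Rightarrow> ('i, rat) mfps" where
  "independence_series G = (\<Sum>S\<in>independent_sets G. \<Prod>i\<in>S. mfps_var i)"

definition multicolorings ::
    "'i pair_pre_digraph \<Rightarrow> ('i \<Rightarrow> nat) \<Rightarrow> nat set \<Rightarrow> ('i \<Rightarrow> nat set) set" where
  "multicolorings G m P =
     {\<tau> \<in> pverts G \<rightarrow>\<^sub>E Pow P.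
        (\<forall>i\<in>pverts G. card (\<tau> i) = m i) \<and> (\<forall>(i, j)\<in>parcs G. \<tau> i \<inter> \<tau> j = {})}"

definition gen_chromatic_poly :: "'i pair_pre_digraph \<Rightarrow> ('i \<Rightarrow> nat) \<Rightarrow> rat poly" where
  "gen_chromatic_poly G m =
     (THE p. \<forall>q :: nat. poly p (of_nat q) = of_nat (card (multicolorings G m {1..q})))"


lemma card_multicolorings_cong:
  fixes G :: "'i pair_pre_digraph"
  assumes wf: "pair_wf_digraph G" and \<phi>: "bij_betw \<phi> P Q"
  shows "card {\<tau> \<in> multicolorings G m P. (\<Union>i\<in>pverts G. \<tau> i) = P} =
         card {\<tau> \<in> multicolorings G m Q. (\<Union>i\<in>pverts G. \<tau> i) = Q}"
    (is "card (?A P) = card (?A Q)")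
proof -
  interpret pair_wf_digraph G by (rule wf)
  have step: "(\<lambda>i\<in>pverts G. \<phi> ` \<tau> i) \<in> ?A Q"
    if \<phi>: "bij_betw \<phi> P Q" and \<tau>: "\<tau> \<in> ?A P" for \<phi> :: "nat \<Rightarrow> nat" and \<tau> P Q
  proof -
    have inj: "inj_on \<phi> P" and im: "\<phi> ` P = Q" using \<phi> by (auto simp: bij_betw_def)
    have sub: "\<tau> i \<subseteq> P" if "i \<in> pverts G" for i
      using \<tau> that by (auto simp: multicolorings_def)
    have "card (\<phi> ` \<tau> i) = m i" if "i \<in> pverts G" for i
      using \<tau> that card_image[OF inj_on_subset[OF inj sub[OF that]]]
      by (auto simp: multicolorings_def)
    moreover have "\<phi> ` \<tau> i \<inter> \<phi> ` \<tau> j = {}" if "(i, j) \<in> parcs G" for i j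
    proof -
      have "\<tau> i \<inter> \<tau> j = {}" using \<tau> that by (auto simp: multicolorings_def)
      thus ?thesis
        using inj_on_image_Int[OF inj sub sub] wellformed'[OF that] by (metis image_empty)
    qed
    moreover have "(\<Union>i\<in>pverts G. \<phi> ` \<tau> i) = Q"
      using \<tau> im by (auto simp flip: image_UN)
    ultimately show ?thesis
      using wellformed' by (fastforce simp: multicolorings_def)
  qed
  define \<psi> where "\<psi> = inv_into P \<phi>"
  have \<psi>: "bij_betw \<psi> Q P" unfolding \<psi>_def by (rule bij_betw_inv_into[OF \<phi>])
  have cancel: "(\<lambda>i\<in>pverts G. \<psi> ` (\<lambda>i\<in>pverts G. \<phi> ` \<tau> i) i) = \<tau>"
    if \<phi>: "bij_betw \<phi> P Q" and \<psi>: "\<And>x. x \<in> P \<Longrightarrow> \<psi> (\<phi> x) = x" and \<tau>: "\<tau> \<in> ?A P"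
    for \<phi> \<psi> :: "nat \<Rightarrow> nat" and \<tau> P Q
  proof
    fix i
    have "\<tau> i \<subseteq> P" if "i \<in> pverts G" using \<tau> that by (auto simp: multicolorings_def)
    hence "\<psi> ` \<phi> ` \<tau> i = \<tau> i" if "i \<in> pverts G"
      using \<psi> that by (force simp: image_image)
    moreover have "\<tau> i = undefined" if "i \<notin> pverts G"
      using \<tau> that by (auto simp: multicolorings_def)
    ultimately show "(\<lambda>i\<in>pverts G. \<psi> ` (\<lambda>i\<in>pverts G. \<phi> ` \<tau> i) i) i = \<tau> i" by auto
  qed
  have "bij_betw (\<lambda>\<tau>. \<lambda>i\<in>pverts G. \<phi> ` \<tau> i) (?A P) (?A Q)"
  proof (rule bij_betw_byWitness[where f' = "\<lambda>\<tau>. \<lambda>i\<in>pverts G. \<psi> ` \<tau> i"])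
    show "\<forall>\<tau>\<in>?A P. (\<lambda>i\<in>pverts G. \<psi> ` (\<lambda>i\<in>pverts G. \<phi> ` \<tau> i) i) = \<tau>"
      using cancel[OF \<phi>, of \<psi>] \<phi> by (auto simp: \<psi>_def bij_betw_def inv_into_f_f)
    show "\<forall>\<tau>\<in>?A Q. (\<lambda>i\<in>pverts G. \<phi> ` (\<lambda>i\<in>pverts G. \<psi> ` \<tau> i) i) = \<tau>"
      using cancel[OF \<psi>, of \<phi>] \<phi> by (auto simp: \<psi>_def bij_betw_def f_inv_into_f)
    show "(\<lambda>\<tau>. \<lambda>i\<in>pverts G. \<phi> ` \<tau> i) ` ?A P \<subseteq> ?A Q"
      using step[OF \<phi>] by blast
    show "(\<lambda>\<tau>. \<lambda>i\<in>pverts G. \<psi> ` \<tau> i) ` ?A Q \<subseteq> ?A P"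
      using step[OF \<psi>] by blast
  qed
  thus ?thesis by (rule bij_betw_same_card)
qed

lemma poly_gen_chromatic_poly:
  assumes "pair_graph G"
  shows "poly (gen_chromatic_poly G m) (of_nat q) = of_nat (card (multicolorings G m {1..q}))"
proof -
  interpret pair_graph G by fact
  let ?un = "\<lambda>\<tau> :: 'a \<Rightarrow> nat set. \<Union>i\<in>pverts G. \<tau> i"
  define A where "A = (\<lambda>P. {\<tau> \<in> multicolorings G m P. ?un \<tau> = P})"
  define N where "N = (\<Sum>i\<in>pverts G. m i)"
  define p :: "rat poly" where
    "p = (\<Sum>k\<le>N. smult (of_nat (card (A {1..k})) / fact k) (\<Prod>i<k. [:- of_nat i, 1:]))"
  have fin: "finite (multicolorings G m {1..q})" for q
    by (rule finite_subset[of _ "pverts G \<rightarrow>\<^sub>E Pow {1..q}"])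
       (auto simp: multicolorings_def intro!: finite_PiE)
  have large: "card (A P) = 0" if "card P > N" for P
  proof -
    have "card (?un \<tau>) \<le> N" if "\<tau> \<in> multicolorings G m P" for \<tau>
    proof -
      have "card (?un \<tau>) \<le> (\<Sum>i\<in>pverts G. card (\<tau> i))"
        by (rule card_UN_le) (rule pair_finite_verts)
      also have "\<dots> = N"
        unfolding N_def using that by (intro sum.cong) (auto simp: multicolorings_def)
      finally show ?thesis .
    qed
    hence "A P = {}" using that by (force simp: A_def)
    thus ?thesis by simp
  qed
  have p: "poly p (of_nat q) = of_nat (card (multicolorings G m {1..q}))" for q :: nat
  proof -
    have *: "multicolorings G m {1..q} = (\<Union>P\<in>Pow {1..q}. A P)"
      by (fastforce simp: A_def multicolorings_def)
    have "card (multicolorings G m {1..q}) = (\<Sum>P\<in>Pow {1..q}. card (A P))"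
      unfolding *
    proof (rule card_UN_disjoint)
      show "\<forall>P\<in>Pow {1..q}. finite (A P)"
      proof
        fix P assume "P \<in> Pow {1..q}"
        hence "A P \<subseteq> multicolorings G m {1..q}" unfolding * by (rule UN_upper)
        thus "finite (A P)" by (rule finite_subset) (rule fin)
      qed
    qed (force simp: A_def)+
    also have "\<dots> = (\<Sum>P\<in>Pow {1..q}. card (A {1..card P}))"
    proof (intro sum.cong refl)
      fix P assume "P \<in> Pow {1..q}"
      hence "finite P" by (auto intro: finite_subset)
      then obtain \<phi> where "bij_betw \<phi> P {1..card P}"
        by (metis card_atLeastAtMost diff_Suc_1 finite_atLeastAtMost finite_same_card_bij)
      thus "card (A P) = card (A {1..card P})"
        unfolding A_def by (intro card_multicolorings_cong) unfold_locales
    qed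
    also have "\<dots> = (\<Sum>k\<le>q. \<Sum>P | P \<in> Pow {1..q} \<and> card P = k. card (A {1..card P}))"
      by (rule sum.group[symmetric]) (auto dest: card_mono[rotated])
    also have "\<dots> = (\<Sum>k\<le>q. (q choose k) * card (A {1..k}))"
      by (intro sum.cong refl) (simp add: n_subsets)
    also have "\<dots> = (\<Sum>k\<le>N + q. (q choose k) * card (A {1..k}))"
      by (intro sum.mono_neutral_left) (auto simp: binomial_eq_0)
    also have "\<dots> = (\<Sum>k\<le>N. (q choose k) * card (A {1..k}))"
      by (intro sum.mono_neutral_right) (auto simp: large)
    finally show ?thesis
      by (auto simp: p_def poly_sum poly_prod binomial_gbinomial gbinomial_prod_rev
          atLeast0LessThan intro!: sum.cong)
  qed
  have unique: "p' = p"
    if "\<forall>q. poly p' (of_nat q) = of_nat (card (multicolorings G m {1..q}))" for p'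
  proof (rule ccontr)
    assume "p' \<noteq> p"
    hence "finite {x. poly (p' - p) x = 0}" by (intro poly_roots_finite) auto
    moreover have "range of_nat \<subseteq> {x. poly (p' - p) x = 0}" using that p by auto
    ultimately have "finite (range (of_nat :: nat \<Rightarrow> rat))" by (rule finite_subset[rotated])
    thus False by (simp add: finite_image_iff inj_on_def)
  qed
  have "gen_chromatic_poly G m = p"
    unfolding gen_chromatic_poly_def using p unique by (intro the_equality) auto
  thus ?thesis using p by simp
qed


section \<open>Falling factorials\<close>

definition ffact :: "'a :: comm_ring_1 \<Rightarrow> nat \<Rightarrow> 'a" where
  "ffact z k = (\<Prod>j<k. z - of_nat j)"

lemma gbinomial_ffact: "z gchoose k = ffact z k / fact k"
  by (simp add: ffact_def gbinomial_prod_rev atLeast0LessThan)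

definition gbinomial_diff :: "'a :: field_char_0 \<Rightarrow> nat \<Rightarrow> 'a" where
  "gbinomial_diff z k = (z gchoose k) - (if k = 0 then 0 else z gchoose (k - 1))"

end

(*
  Counting by colours: I(G)^q is the generating series of the multicolourings with q colours, hence
  it equals the series P(z) with coefficients pi_G^m(z) at z = q. The identity I(G)^q P(z) = P(q + z)
  holds for z in N, so for all z because both sides have polynomial coefficients, and z = -q gives
  P(-q) = I(G)^(-q).

  On the cycle, the number of multicolourings with q colours is the trace of a product of
  disjointness matrices K(A, B) = [A and B disjoint], indexed by subsets of X = {1..q} of sizes
  m_i and m_(i+1). Instead of decomposing the permutation modules of Sym(X) into irreducibles, it
  suffices to know one vector of each isotypic component: the product over i < k of
  [2i+1 in B] - [2i+2 in B] is mapped by K to a multiple of itself. The trace of a Sym(X)-invariant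
  operator on the a-subsets is the sum over k <= a of its eigenvalue on this vector times the
  multiplicity v_k(q). By linearity this reduces to the identity, where it telescopes, and to
  operators factoring through the j-subsets for some j < a, where induction applies since
  trace(U V) = trace(V U). The resulting formula, valid for large q, extends to all z because both
  sides are polynomials.
*)

theory Submission
  imports Defs
begin

section \<open>Sums of the test vectors over subsets and supersets\<close>

section \<open>Alternating functions on subsets\<close>

definition subsets_of_card :: "'a set \<Rightarrow> nat \<Rightarrow> 'a set set" where
  "subsets_of_card X b = {B. B \<subseteq> X \<and> card B = b}"

lemma finite_subsets_of_card [simp]: "finite X \<Longrightarrow> finite (subsets_of_card X b)"
  by (rule finite_subset[of _ "Pow X"]) (auto simp: subsets_of_card_def)

lemma card_subsets_of_card [simp]:
  "finite X \<Longrightarrow> card (subsets_of_card X b) = card X choose b"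
  unfolding subsets_of_card_def by (rule n_subsets)

lemma sum_subsets_of_card_member:
  assumes "finite Y" "c \<in> Y"
  shows "(\<Sum>B\<in>subsets_of_card Y (Suc b). f B * of_bool (c \<in> B)) =
         (\<Sum>B\<in>subsets_of_card (Y - {c}) b. f (insert c B) :: 'b :: semiring_1)"
proof -
  have fin: "finite B" if "B \<subseteq> Y" for B
    using that assms(1) by (rule finite_subset)
  have "(\<Sum>B\<in>subsets_of_card Y (Suc b). f B * of_bool (c \<in> B)) =
        (\<Sum>B\<in>{B \<in> subsets_of_card Y (Suc b). c \<in> B}. f B)"
    using assms(1) by (intro sum.mono_neutral_cong_right) auto
  also have "\<dots> = (\<Sum>B\<in>subsets_of_card (Y - {c}) b. f (insert c B))"
    using assms
    by (intro sum.reindex_bij_witness[where i = "insert c" and j = "\<lambda>B. B - {c}"])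
       (auto simp: subsets_of_card_def insert_absorb card_insert_if card_Diff_singleton
          subset_Diff_insert dest: fin)
  finally show ?thesis .
qed

text \<open>On k-subsets of \<open>{1..q}\<close> this is a polytabloid of the two-row shape (q - k,
  k), supported on the sets with one point in each pair {2i+1, 2i+2}. It refers neither to a ground
  set nor to the size of \<open>B\<close>, so a single function serves as test vector on all
  \<open>subsets_of_card X b\<close>.\<close>

definition alternating :: "nat \<Rightarrow> nat set \<Rightarrow> rat" where
  "alternating k B = (\<Prod>i<k. of_bool (2 * i + 1 \<in> B) - of_bool (2 * i + 2 \<in> B))"

lemma alternating_0 [simp]: "alternating 0 B = 1"
  by (simp add: alternating_def)

lemma alternating_Suc:
  "alternating (Suc k) B =
     alternating k B * of_bool (2 * k + 1 \<in> B) - alternating k B * of_bool (2 * k + 2 \<in> B)"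
  by (simp add: alternating_def algebra_simps)

lemma alternating_cong:
  "(\<And>c. c \<in> {1..2 * k} \<Longrightarrow> c \<in> A \<longleftrightarrow> c \<in> B) \<Longrightarrow> alternating k A = alternating k B"
  unfolding alternating_def by (intro prod.cong refl) auto

text \<open>Complementing negates each of the k differences; the bound places all k pairs inside
  \<open>{1..q}\<close>.\<close>

lemma alternating_complement:
  assumes "2 * k \<le> q"
  shows "alternating k ({1..q} - A) = (- 1) ^ k * alternating k A"
proof -
  have "alternating k ({1..q} - A) =
      (\<Prod>i<k. - 1 * (of_bool (2 * i + 1 \<in> A) - of_bool (2 * i + 2 \<in> A)))"
    unfolding alternating_def using assms by (intro prod.cong refl) auto
  thus ?thesis by (simp only: alternating_def prod.distrib prod_constant card_lessThan)
qed

text \<open>If \<open>Y\<close> contains both points of a pair, exchanging them cancels the terms;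
  if it misses both, every term vanishes. Otherwise the k points of \<open>Y\<close> in the pairs
  are forced into \<open>B\<close> and the remaining b - k points are free. The induction realizes
  this by splitting the last factor into two membership indicators.\<close>

lemma sum_alternating:
  assumes "finite Y"
  shows "(\<Sum>B\<in>subsets_of_card Y b. alternating k B) =
         (if k \<le> b then alternating k Y * of_nat ((card Y - k) choose (b - k)) else 0)"
  using assms
proof (induction k arbitrary: Y b)
  case 0
  thus ?case by simp
next
  case (Suc k)
  \<comment> \<open>A point beyond the first k pairs can be deleted without changing
    \<open>alternating k\<close>, so the induction hypothesis applies to \<open>Y - {c}\<close> and
    b - 1.\<close>
  have member: "(\<Sum>B\<in>subsets_of_card Y b. alternating k B * of_bool (c \<in> B)) =
      (if Suc k \<le> b
       then alternating k Y * of_bool (c \<in> Y) * of_nat ((card Y - Suc k) choose (b - Suc k)) else 0)"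
    if c: "c > 2 * k" for c
  proof (cases "c \<in> Y")
    case False
    hence "(\<Sum>B\<in>subsets_of_card Y b. alternating k B * of_bool (c \<in> B)) = 0"
      by (intro sum.neutral) (auto simp: subsets_of_card_def)
    thus ?thesis using False by simp
  next
    case True
    show ?thesis
    proof (cases b)
      case 0
      have "(\<Sum>B\<in>subsets_of_card Y b. alternating k B * of_bool (c \<in> B)) = 0"
        using 0 finite_subset[OF _ Suc.prems]
        by (intro sum.neutral) (fastforce simp: subsets_of_card_def)
      thus ?thesis using 0 by simp
    next
      case b: (Suc b')
      have *: "alternating k (insert c B) = alternating k B"
        "alternating k (B - {c}) = alternating k B" for B
        using c by (auto intro: alternating_cong)
      show ?thesis
        unfolding b sum_subsets_of_card_member[OF Suc.prems True]
        using Suc True by (simp add: * card_Diff_singleton)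
    qed
  qed
  show ?case
    by (auto simp: alternating_Suc sum_subtractf member algebra_simps)
qed

text \<open>Complements turn supersets of \<open>J\<close> into subsets of \<open>X - J\<close>,
  where \<open>sum_alternating\<close> applies; the signs from complementing \<open>B\<close> and
  \<open>J\<close> cancel. The bound \<open>a + k \<le> q\<close> selects the first branch
  there.\<close>

lemma sum_alternating_superset:
  fixes q :: nat
  defines "X \<equiv> {1..q}"
  assumes "J \<subseteq> X" "2 * k \<le> q" "a + k \<le> q"
  shows "(\<Sum>B | B \<in> subsets_of_card X a \<and> J \<subseteq> B. alternating k B) =
         alternating k J * of_nat ((q - card J - k) choose (q - a - k))"
proof -
  have [simp]: "card X = q" "finite X" by (auto simp: X_def)
  have card: "card (X - B) = q - card B" if "B \<subseteq> X - C" for B C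
    using that finite_subset[of B X] by (subst card_Diff_subset) (auto simp: X_def)
  have "(\<Sum>B | B \<in> subsets_of_card X a \<and> J \<subseteq> B. alternating k B) =
        (\<Sum>B\<in>subsets_of_card (X - J) (q - a). (- 1) ^ k * alternating k B)"
    using assms(2-) alternating_complement[of k q, folded X_def]
    by (intro sum.reindex_bij_witness[where i = "\<lambda>B. X - B" and j = "\<lambda>B. X - B"])
       (auto simp: subsets_of_card_def card[of _ "{}", simplified] card double_diff
         simp flip: power_mult_distrib mult.assoc)
  also have "\<dots> = (- 1) ^ k * ((- 1) ^ k * alternating k J *
      of_nat ((q - card J - k) choose (q - a - k)))"
    using assms(2-) card[of J "{}"] alternating_complement[of k q, folded X_def]
    by (simp add: sum_distrib_left[symmetric] sum_alternating)
  also have "\<dots> = alternating k J * of_nat ((q - card J - k) choose (q - a - k))"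
    by (simp flip: power_mult_distrib mult.assoc)
  finally show ?thesis .
qed

lemma alternating_nonzero:
  assumes "k \<le> a" "a + k \<le> q"
  shows "\<exists>A\<in>subsets_of_card {1..q} a. alternating k A \<noteq> 0"
proof
  \<comment> \<open>The odd points 1, 3, ..., 2k - 1 make every factor equal to 1; the a - k points
    after 2k fill up the cardinality.\<close>
  let ?A = "(\<lambda>i. 2 * i + 1) ` {..<k} \<union> {2 * k + 1..a + k}"
  have "card ?A = card ((\<lambda>i. 2 * i + 1 :: nat) ` {..<k}) + card {2 * k + 1..a + k}"
    by (rule card_Un_disjoint) auto
  also have "card ((\<lambda>i. 2 * i + 1 :: nat) ` {..<k}) = k"
    by (subst card_image) (auto simp: inj_on_def)
  finally show "?A \<in> subsets_of_card {1..q} a"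
    using assms by (auto simp: subsets_of_card_def)
  have "2 * i + 2 \<notin> ?A" if "i < k" for i
  proof
    assume "2 * i + 2 \<in> ?A"
    hence "\<exists>j. Suc (2 * i) = 2 * j" using that by auto
    thus False by presburger
  qed
  hence "alternating k ?A = (\<Prod>i<k. 1)"
    unfolding alternating_def by (intro prod.cong refl) auto
  thus "alternating k ?A \<noteq> 0" by simp
qed

section \<open>Trace of an invariant kernel from its eigenvalues on the test vectors\<close>

section \<open>Traces of permutation-invariant kernels\<close>

definition invariant_kernel :: "nat set \<Rightarrow> (nat set \<Rightarrow> nat set \<Rightarrow> rat) \<Rightarrow> bool" where
  "invariant_kernel X F \<longleftrightarrow>
     (\<forall>\<sigma> A B. bij_betw \<sigma> X X \<longrightarrow> A \<subseteq> X \<longrightarrow> B \<subseteq> X \<longrightarrow> F (\<sigma> ` A) (\<sigma> ` B) = F A B)"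

lemma invariant_kernel_image:
  "invariant_kernel X F \<Longrightarrow> bij_betw \<sigma> X X \<Longrightarrow> A \<subseteq> X \<Longrightarrow> B \<subseteq> X \<Longrightarrow>
     F (\<sigma> ` A) (\<sigma> ` B) = F A B"
  by (simp add: invariant_kernel_def)

lemma sum_subsets_of_card_image:
  assumes "bij_betw \<sigma> X X"
  shows "(\<Sum>B\<in>subsets_of_card X b. f (\<sigma> ` B)) = (\<Sum>B\<in>subsets_of_card X b. f B)"
proof (rule sum.reindex_bij_betw)
  have inj: "inj_on \<sigma> B" if "B \<subseteq> X" for B
    using assms that by (auto simp: bij_betw_def intro: inj_on_subset)
  show "bij_betw ((`) \<sigma>) (subsets_of_card X b) (subsets_of_card X b)"
  proof (rule bij_betw_byWitness[where f' = "(`) (inv_into X \<sigma>)"])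
    have "bij_betw (inv_into X \<sigma>) X X" by (rule bij_betw_inv_into[OF assms])
    hence inj': "inj_on (inv_into X \<sigma>) B" and im: "inv_into X \<sigma> ` X = X" if "B \<subseteq> X" for B
      using that by (auto simp: bij_betw_def intro: inj_on_subset)
    show "(`) \<sigma> ` subsets_of_card X b \<subseteq> subsets_of_card X b"
      using assms by (auto simp: subsets_of_card_def card_image inj bij_betw_def)
    show "(`) (inv_into X \<sigma>) ` subsets_of_card X b \<subseteq> subsets_of_card X b"
      using im by (auto simp: subsets_of_card_def card_image inj')
  qed (use assms in \<open>auto simp: subsets_of_card_def bij_betw_def
         image_inv_into_cancel inv_into_image_cancel\<close>)
qed

text \<open>The three cardinalities determine the orbit of a pair of subsets: they force equal sizes
  for the four cells \<open>A \<inter> B\<close>, \<open>A - B\<close>, \<open>B - A\<close> and the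
  rest of \<open>X\<close>, and bijections between the cells are glued.\<close>

lemma bij_betw_mapping_pair:
  assumes "finite X" "A \<subseteq> X" "B \<subseteq> X" "A' \<subseteq> X" "B' \<subseteq> X"
    and "card A = card A'" "card B = card B'" "card (A \<inter> B) = card (A' \<inter> B')"
  obtains \<sigma> where "bij_betw \<sigma> X X" "\<sigma> ` A = A'" "\<sigma> ` B = B'"
proof -
  have fin: "finite Y" if "Y \<subseteq> X" for Y using that assms(1) by (rule finite_subset)
  have ex: "\<exists>\<sigma>. bij_betw \<sigma> Y Y'" if "Y \<subseteq> X" "Y' \<subseteq> X" "card Y = card Y'" for Y Y'
    using finite_same_card_bij[OF fin fin] that by blast
  have diff: "card (A - B) = card A - card (A \<inter> B)" if "A \<subseteq> X" "B \<subseteq> X" for A B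
    using that by (simp add: card_Diff_subset_Int fin)
  have un: "card (A \<union> B) = card A + card B - card (A \<inter> B)" if "A \<subseteq> X" "B \<subseteq> X" for A B
    using that card_Un_Int[of A B] by (simp add: fin)
  obtain f1 where f1: "bij_betw f1 (A \<inter> B) (A' \<inter> B')"
    using ex[of "A \<inter> B" "A' \<inter> B'"] assms by auto
  obtain f2 where f2: "bij_betw f2 (A - B) (A' - B')"
    using ex[of "A - B" "A' - B'"] assms diff by auto
  have "card (B - A) = card (B' - A')"
    using assms diff by (simp add: Int_commute)
  then obtain f3 where f3: "bij_betw f3 (B - A) (B' - A')"
    using ex[of "B - A" "B' - A'"] assms(3,5) by auto
  have "card (X - (A \<union> B)) = card (X - (A' \<union> B'))"
    using assms by (simp add: card_Diff_subset fin un)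
  then obtain f4 where f4: "bij_betw f4 (X - (A \<union> B)) (X - (A' \<union> B'))"
    using ex[of "X - (A \<union> B)" "X - (A' \<union> B')"] by auto
  define \<sigma> where "\<sigma> = (\<lambda>x. if x \<in> A then if x \<in> B then f1 x else f2 x
                        else if x \<in> B then f3 x else f4 x)"
  have \<sigma>: "bij_betw \<sigma> (A \<inter> B) (A' \<inter> B')" "bij_betw \<sigma> (A - B) (A' - B')"
    "bij_betw \<sigma> (B - A) (B' - A')" "bij_betw \<sigma> (X - (A \<union> B)) (X - (A' \<union> B'))"
    by (rule bij_betw_cong[THEN iffD1, OF _ f1] bij_betw_cong[THEN iffD1, OF _ f2]
          bij_betw_cong[THEN iffD1, OF _ f3] bij_betw_cong[THEN iffD1, OF _ f4];
        simp add: \<sigma>_def)+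
  have A: "bij_betw \<sigma> A A'"
    using bij_betw_combine[OF \<sigma>(1,2)] by (simp add: Int_Diff_Un Int_Diff_disjoint)
  have un': "bij_betw \<sigma> (A \<union> (B - A)) (A' \<union> (B' - A'))"
    by (rule bij_betw_combine[OF A \<sigma>(3)]) auto
  have "bij_betw \<sigma> (A \<union> (B - A) \<union> (X - (A \<union> B))) (A' \<union> (B' - A') \<union> (X - (A' \<union> B')))"
    by (rule bij_betw_combine[OF un' \<sigma>(4)]) auto
  moreover have "A \<union> (B - A) \<union> (X - (A \<union> B)) = X" "A' \<union> (B' - A') \<union> (X - (A' \<union> B')) = X"
    using assms by auto
  ultimately have "bij_betw \<sigma> X X" by simp
  moreover have "\<sigma> ` A = A'" using A by (simp add: bij_betw_def)
  moreover have "\<sigma> ` B = B'"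
  proof -
    have "\<sigma> ` B = \<sigma> ` (A \<inter> B) \<union> \<sigma> ` (B - A)" by auto
    thus ?thesis using \<sigma>(1,3) by (auto simp: bij_betw_def)
  qed
  ultimately show ?thesis using that by blast
qed

text \<open>The system is triangular: \<open>s choose Suc a\<close> is 0 for s <= a and 1 at s = a +
  1, so the new coefficient corrects the value there and disturbs no earlier one.\<close>

lemma newton_expansion:
  "\<exists>c :: nat \<Rightarrow> rat. \<forall>s\<le>a. g s = (\<Sum>j\<le>a. c j * of_nat (s choose j))"
proof (induction a)
  case 0
  show ?case by (rule exI[of _ "\<lambda>_. g 0"]) simp
next
  case (Suc a)
  then obtain c where c: "\<forall>s\<le>a. g s = (\<Sum>j\<le>a. c j * of_nat (s choose j))" by blast
  define c' where "c' = c(Suc a := g (Suc a) - (\<Sum>j\<le>a. c j * of_nat (Suc a choose j)))"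
  have "g s = (\<Sum>j\<le>Suc a. c' j * of_nat (s choose j))" if "s \<le> Suc a" for s
    using that c by (cases "s = Suc a") (auto simp: c'_def binomial_eq_0)
  thus ?case by blast
qed

text \<open>Invariance makes \<open>F A B\<close> a function of \<open>card (A \<inter> B)\<close>
  alone, because pairs with equal intersection size lie in one orbit. Newton interpolation then
  expresses it by kernels that factor through j-subsets.\<close>

lemma invariant_kernel_expansion:
  assumes "finite X" "invariant_kernel X F"
  obtains c where "\<And>A B. A \<in> subsets_of_card X a \<Longrightarrow> B \<in> subsets_of_card X a \<Longrightarrow>
    F A B = (\<Sum>j\<le>a. c j * of_nat (card (A \<inter> B) choose j))"
proof -
  have same: "F A B = F A' B'"
    if "A \<in> subsets_of_card X a" "B \<in> subsets_of_card X a" "A' \<in> subsets_of_card X a"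
      "B' \<in> subsets_of_card X a" "card (A \<inter> B) = card (A' \<inter> B')" for A B A' B'
  proof -
    have sub: "A \<subseteq> X" "B \<subseteq> X" "A' \<subseteq> X" "B' \<subseteq> X" "card A = card A'" "card B = card B'"
      "card (A \<inter> B) = card (A' \<inter> B')"
      using that by (auto simp: subsets_of_card_def)
    obtain \<sigma> where "bij_betw \<sigma> X X" "\<sigma> ` A = A'" "\<sigma> ` B = B'"
      by (rule bij_betw_mapping_pair[OF assms(1) sub])
    thus ?thesis using invariant_kernel_image[OF assms(2) _ sub(1,2)] by metis
  qed
  have "\<exists>v. \<forall>A\<in>subsets_of_card X a. \<forall>B\<in>subsets_of_card X a. card (A \<inter> B) = s \<longrightarrow> F A B = v" for s
  proof (cases "\<exists>A\<in>subsets_of_card X a. \<exists>B\<in>subsets_of_card X a. card (A \<inter> B) = s")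
    case True
    then obtain A\<^sub>0 B\<^sub>0 where "A\<^sub>0 \<in> subsets_of_card X a" "B\<^sub>0 \<in> subsets_of_card X a"
      "card (A\<^sub>0 \<inter> B\<^sub>0) = s" by blast
    hence "\<forall>A\<in>subsets_of_card X a. \<forall>B\<in>subsets_of_card X a.
        card (A \<inter> B) = s \<longrightarrow> F A B = F A\<^sub>0 B\<^sub>0"
      by (intro ballI impI same) simp_all
    thus ?thesis by blast
  qed blast
  then obtain g where g: "\<And>A B. A \<in> subsets_of_card X a \<Longrightarrow> B \<in> subsets_of_card X a \<Longrightarrow>
      F A B = g (card (A \<inter> B))"
    by metis
  obtain c :: "nat \<Rightarrow> rat" where "\<forall>s\<le>a. g s = (\<Sum>j\<le>a. c j * of_nat (s choose j))"
    using newton_expansion by blast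
  moreover have "card (A \<inter> B) \<le> a" if "A \<in> subsets_of_card X a" for A B
    using that assms(1) card_mono[of A "A \<inter> B"] finite_subset[of A X]
    by (auto simp: subsets_of_card_def)
  ultimately show ?thesis using that[of c] g by simp
qed


text \<open>The binomial counts the j-sets contained in both \<open>A\<close> and \<open>B\<close>,
  so this kernel is \<open>V V^T\<close> for the inclusion matrix V between a-subsets and j-subsets.
  Summing over the \<open>B\<close> above \<open>J\<close> and then over the \<open>J\<close> inside
  \<open>A\<close> yields the two binomial factors of the eigenvalue.\<close>

lemma sum_alternating_superset_subset:
  fixes q :: nat
  defines "X \<equiv> {1..q}"
  assumes "2 * k \<le> q" "a + k \<le> q" "A \<in> subsets_of_card X a"
  shows "(\<Sum>B\<in>subsets_of_card X a. of_nat (card (A \<inter> B) choose j) * alternating k B) =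
         (if k \<le> j then of_nat ((a - k) choose (j - k)) * of_nat ((q - j - k) choose (q - a - k)) else 0)
           * alternating k A"
proof -
  have [simp]: "finite X" by (simp add: X_def)
  have fin: "finite B" if "B \<subseteq> X" for B
    using that by (rule finite_subset) simp
  have A: "A \<subseteq> X" "card A = a" "finite A"
    using assms(4) fin by (auto simp: subsets_of_card_def)
  have "(\<Sum>B\<in>subsets_of_card X a. of_nat (card (A \<inter> B) choose j) * alternating k B) =
        (\<Sum>B\<in>subsets_of_card X a. \<Sum>J\<in>subsets_of_card A j. of_bool (J \<subseteq> B) * alternating k B)"
  proof (intro sum.cong refl)
    fix B
    have "card (A \<inter> B) choose j = card (subsets_of_card (A \<inter> B) j)"
      using A by simp
    also have "subsets_of_card (A \<inter> B) j = {J \<in> subsets_of_card A j. J \<subseteq> B}"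
      by (auto simp: subsets_of_card_def)
    also have "of_nat (card \<dots>) = (\<Sum>J\<in>subsets_of_card A j. of_bool (J \<subseteq> B) :: rat)"
      using A(3) by (simp add: Int_def)
    finally show "of_nat (card (A \<inter> B) choose j) * alternating k B =
        (\<Sum>J\<in>subsets_of_card A j. of_bool (J \<subseteq> B) * alternating k B)"
      by (simp only: sum_distrib_right)
  qed
  also have "\<dots> = (\<Sum>J\<in>subsets_of_card A j. \<Sum>B | B \<in> subsets_of_card X a \<and> J \<subseteq> B. alternating k B)"
    by (subst sum.swap, intro sum.cong refl sum.mono_neutral_cong_right) auto
  also have "\<dots> = (\<Sum>J\<in>subsets_of_card A j. alternating k J * of_nat ((q - j - k) choose (q - a - k)))"
    using A(1) assms(2,3)
    by (intro sum.cong refl, unfold X_def, subst sum_alternating_superset)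
       (auto simp: subsets_of_card_def)
  also have "\<dots> = (if k \<le> j then of_nat ((a - k) choose (j - k)) * of_nat ((q - j - k) choose (q - a - k)) else 0)
           * alternating k A"
    using A by (simp add: sum_distrib_right[symmetric] sum_alternating)
  finally show ?thesis .
qed

text \<open>This is \<open>V^T V\<close>, with the two sums taken in the opposite order; hence the
  eigenvalue agrees with that of \<open>V V^T\<close>.\<close>

lemma sum_alternating_subset_superset:
  fixes q :: nat
  defines "X \<equiv> {1..q}"
  assumes "2 * k \<le> q" "a + k \<le> q" "k \<le> j" "J \<in> subsets_of_card X j"
  shows "(\<Sum>I\<in>subsets_of_card X j.
           of_nat (card {B \<in> subsets_of_card X a. J \<subseteq> B \<and> I \<subseteq> B}) * alternating k I) =
         of_nat ((a - k) choose (j - k)) * of_nat ((q - j - k) choose (q - a - k)) * alternating k J"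
proof -
  have [simp]: "finite X" by (simp add: X_def)
  have fin: "finite B" if "B \<subseteq> X" for B
    using that by (rule finite_subset) simp
  have J: "J \<subseteq> X" "card J = j"
    using assms(5) by (auto simp: subsets_of_card_def)
  have "(\<Sum>I\<in>subsets_of_card X j.
          of_nat (card {B \<in> subsets_of_card X a. J \<subseteq> B \<and> I \<subseteq> B}) * alternating k I) =
        (\<Sum>I\<in>subsets_of_card X j. \<Sum>B | B \<in> subsets_of_card X a \<and> J \<subseteq> B.
          of_bool (I \<subseteq> B) * alternating k I)"
    by (simp add: sum_distrib_right[symmetric] Int_def conj_assoc)
  also have "\<dots> = (\<Sum>B | B \<in> subsets_of_card X a \<and> J \<subseteq> B. \<Sum>I\<in>subsets_of_card B j. alternating k I)"
    by (subst sum.swap, intro sum.cong refl sum.mono_neutral_cong_right)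
       (auto simp: subsets_of_card_def)
  also have "\<dots> = (\<Sum>B | B \<in> subsets_of_card X a \<and> J \<subseteq> B.
      alternating k B * of_nat ((a - k) choose (j - k)))"
    using assms(4)
    by (intro sum.cong refl, subst sum_alternating) (auto simp: subsets_of_card_def fin)
  also have "\<dots> = of_nat ((a - k) choose (j - k)) * of_nat ((q - j - k) choose (q - a - k)) * alternating k J"
    using sum_alternating_superset[OF J(1)[unfolded X_def] assms(2,3), folded X_def] J(2)
    by (simp add: sum_distrib_right[symmetric])
  finally show ?thesis .
qed

text \<open>Double counting of inclusions, which amounts to trace(V^T V) = trace(V V^T).\<close>

lemma sum_card_supersets:
  assumes "finite X"
  shows "(\<Sum>J\<in>subsets_of_card X j. card {B \<in> subsets_of_card X a. J \<subseteq> B}) =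
         (\<Sum>B\<in>subsets_of_card X a. a choose j)"
proof -
  have fin: "finite B" if "B \<subseteq> X" for B
    using that assms by (rule finite_subset)
  have "(\<Sum>J\<in>subsets_of_card X j. card {B \<in> subsets_of_card X a. J \<subseteq> B}) =
        (\<Sum>J\<in>subsets_of_card X j. \<Sum>B\<in>subsets_of_card X a. of_bool (J \<subseteq> B))"
    using assms by (simp add: Int_def)
  also have "\<dots> = (\<Sum>B\<in>subsets_of_card X a. \<Sum>J\<in>subsets_of_card X j. of_bool (J \<subseteq> B))"
    by (rule sum.swap)
  also have "\<dots> = (\<Sum>B\<in>subsets_of_card X a. card (subsets_of_card B j))"
    using assms
    by (intro sum.cong refl) (auto simp: subsets_of_card_def Int_def intro!: arg_cong[of _ _ card])
  also have "\<dots> = (\<Sum>B\<in>subsets_of_card X a. a choose j)"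
    by (intro sum.cong refl) (auto simp: fin subsets_of_card_def n_subsets)
  finally show ?thesis .
qed

text \<open>A permutation of \<open>X\<close> permutes the a-sets \<open>B\<close>. This qualifies
  \<open>V^T V\<close> for the induction in the trace formula.\<close>

lemma invariant_kernel_card_supersets:
  assumes "finite X"
  shows "invariant_kernel X (\<lambda>J I. of_nat (card {B \<in> subsets_of_card X a. J \<subseteq> B \<and> I \<subseteq> B}))"
  unfolding invariant_kernel_def
proof (intro allI impI)
  fix \<sigma> J I assume \<sigma>: "bij_betw \<sigma> X X" and JI: "J \<subseteq> X" "I \<subseteq> X"
  have card: "card {B \<in> subsets_of_card X a. P B} = (\<Sum>B\<in>subsets_of_card X a. of_bool (P B))" for P
    using assms by (simp add: Int_def)
  have iff: "\<sigma> ` J \<subseteq> \<sigma> ` B \<longleftrightarrow> J \<subseteq> B" if "J \<subseteq> X" "B \<in> subsets_of_card X a" for J B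
  proof -
    have "\<sigma> x \<in> \<sigma> ` B \<longleftrightarrow> x \<in> B" if "x \<in> J" for x
      using \<sigma> that \<open>J \<subseteq> X\<close> \<open>B \<in> _\<close>
      by (intro inj_on_image_mem_iff[of \<sigma> X]) (auto simp: bij_betw_def subsets_of_card_def)
    thus ?thesis by (auto simp: image_subset_iff)
  qed
  have "card {B \<in> subsets_of_card X a. \<sigma> ` J \<subseteq> B \<and> \<sigma> ` I \<subseteq> B} =
        (\<Sum>B\<in>subsets_of_card X a. of_bool (\<sigma> ` J \<subseteq> \<sigma> ` B \<and> \<sigma> ` I \<subseteq> \<sigma> ` B))"
    unfolding card by (rule sum_subsets_of_card_image[OF \<sigma>, symmetric])
  also have "\<dots> = card {B \<in> subsets_of_card X a. J \<subseteq> B \<and> I \<subseteq> B}"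
    unfolding card by (intro sum.cong refl) (simp only: iff JI)
  finally show "(of_nat (card {B \<in> subsets_of_card X a. \<sigma> ` J \<subseteq> B \<and> \<sigma> ` I \<subseteq> B}) :: rat) =
      of_nat (card {B \<in> subsets_of_card X a. J \<subseteq> B \<and> I \<subseteq> B})" by simp
qed

text \<open>The sum telescopes. At z = q it says that the multiplicities add up to the number of
  a-subsets, the trace of the identity.\<close>

lemma sum_gbinomial_diff:
  "(\<Sum>k\<le>a. gbinomial_diff z k) = (z gchoose a)"
  by (induction a) (auto simp: gbinomial_diff_def)

text \<open>Both sides are linear in \<open>F\<close>, since \<mu> is determined by
  \<open>F\<close>; so it suffices to treat the kernels \<open>card (A \<inter> B) choose j\<close>.
  The induction on a is over all \<open>F\<close> and \<mu> because the case j < a passes to a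
  different kernel, on j-subsets.\<close>

lemma trace_invariant_kernel:
  fixes q :: nat
  defines "X \<equiv> {1..q}"
  assumes "invariant_kernel X F" "2 * a \<le> q"
    and "\<And>k A. k \<le> a \<Longrightarrow> A \<in> subsets_of_card X a \<Longrightarrow>
      (\<Sum>B\<in>subsets_of_card X a. F A B * alternating k B) = \<mu> k * alternating k A"
  shows "(\<Sum>A\<in>subsets_of_card X a. F A A) = (\<Sum>k\<le>a. gbinomial_diff (of_nat q) k * \<mu> k)"
  using assms(2-)
proof (induction a arbitrary: F \<mu> rule: less_induct)
  case (less a)
  have [simp]: "finite X" "card X = q" by (auto simp: X_def)
  \<comment> \<open>The eigenvalue of \<open>card (A \<inter> B) choose j\<close> on
    \<open>alternating k\<close>. It is 0 for k > j, which later extends a sum from k <= j to k <=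
    a.\<close>
  define \<rho> where "\<rho> = (\<lambda>j k. if k \<le> j
    then of_nat ((a - k) choose (j - k)) * of_nat ((q - j - k) choose (q - a - k)) else (0 :: rat))"
  (* For the kernel binom(|A \<inter> B|, j) with j < a, which is V V^T for the inclusion matrix V between
     a-subsets and j-subsets, the claim for V^T V on the j-subsets applies. *)
  have basis: "(\<Sum>A\<in>subsets_of_card X a. of_nat (a choose j)) =
      (\<Sum>k\<le>a. gbinomial_diff (of_nat q) k * \<rho> j k)" if "j \<le> a" for j
  proof (cases "j = a")
    \<comment> \<open>For j = a the kernel is the identity on a-subsets, and
      \<open>\<rho> a k\<close> is 1 for all k <= a.\<close>
    case True
    thus ?thesis
      using less.prems(2)
      by (simp add: \<rho>_def sum_gbinomial_diff binomial_gbinomial)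
  next
    case False
    hence j: "j < a" using that by simp
    have "(\<Sum>A\<in>subsets_of_card X a. of_nat (a choose j)) =
        (\<Sum>J\<in>subsets_of_card X j. of_nat (card {B \<in> subsets_of_card X a. J \<subseteq> B \<and> J \<subseteq> B}) :: rat)"
      using arg_cong[OF sum_card_supersets[of X a j], of "of_nat :: nat \<Rightarrow> rat"] by simp
    also have "\<dots> = (\<Sum>k\<le>j. gbinomial_diff (of_nat q) k * \<rho> j k)"
    proof (rule less.IH[OF j, where \<mu> = "\<rho> j" and
          F = "\<lambda>J I. of_nat (card {B \<in> subsets_of_card X a. J \<subseteq> B \<and> I \<subseteq> B})"])
      fix k J assume "k \<le> j" "J \<in> subsets_of_card X j"
      thus "(\<Sum>I\<in>subsets_of_card X j.
              of_nat (card {B \<in> subsets_of_card X a. J \<subseteq> B \<and> I \<subseteq> B}) * alternating k I) =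
            \<rho> j k * alternating k J"
        using sum_alternating_subset_superset[of k q a j J, folded X_def] less.prems(2) j
        by (simp add: \<rho>_def)
    qed (use less.prems(2) j in \<open>auto intro: invariant_kernel_card_supersets\<close>)
    also have "\<dots> = (\<Sum>k\<le>a. gbinomial_diff (of_nat q) k * \<rho> j k)"
      using j by (intro sum.mono_neutral_left) (auto simp: \<rho>_def)
    finally show ?thesis .
  qed
  obtain c where c: "\<And>A B. A \<in> subsets_of_card X a \<Longrightarrow> B \<in> subsets_of_card X a \<Longrightarrow>
      F A B = (\<Sum>j\<le>a. c j * of_nat (card (A \<inter> B) choose j))"
    using invariant_kernel_expansion[OF _ less.prems(1)] by auto
  \<comment> \<open>The eigenvalues of \<open>F\<close> and of its expansion are compared at a set
    where the test vector does not vanish.\<close>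
  have \<mu>: "\<mu> k = (\<Sum>j\<le>a. c j * \<rho> j k)" if "k \<le> a" for k
  proof -
    have "a + k \<le> q" using that less.prems(2) by simp
    then obtain A where A: "A \<in> subsets_of_card X a" "alternating k A \<noteq> 0"
      using alternating_nonzero[OF \<open>k \<le> a\<close>] by (auto simp: X_def)
    have "\<mu> k * alternating k A = (\<Sum>B\<in>subsets_of_card X a. F A B * alternating k B)"
      using less.prems(3) that A by simp
    also have "\<dots> = (\<Sum>B\<in>subsets_of_card X a.
        \<Sum>j\<le>a. c j * (of_nat (card (A \<inter> B) choose j) * alternating k B))"
      using A c by (intro sum.cong refl) (simp add: sum_distrib_right mult.assoc)
    also have "\<dots> = (\<Sum>j\<le>a. c j *
        (\<Sum>B\<in>subsets_of_card X a. of_nat (card (A \<inter> B) choose j) * alternating k B))"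
      by (subst sum.swap) (simp add: sum_distrib_left)
    also have "\<dots> = (\<Sum>j\<le>a. c j * (\<rho> j k * alternating k A))"
      using sum_alternating_superset_subset[of k q a A, folded X_def] A that less.prems(2)
      by (simp add: \<rho>_def)
    also have "\<dots> = (\<Sum>j\<le>a. c j * \<rho> j k) * alternating k A"
      by (simp add: sum_distrib_right mult.assoc)
    finally show ?thesis using A(2) by simp
  qed
  have "(\<Sum>A\<in>subsets_of_card X a. F A A) =
      (\<Sum>A\<in>subsets_of_card X a. \<Sum>j\<le>a. c j * of_nat (a choose j))"
    using c by (intro sum.cong refl) (simp add: subsets_of_card_def)
  also have "\<dots> = (\<Sum>j\<le>a. c j * (\<Sum>A\<in>subsets_of_card X a. of_nat (a choose j)))"
    by (subst sum.swap) (simp only: sum_distrib_left)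
  also have "\<dots> = (\<Sum>j\<le>a. c j * (\<Sum>k\<le>a. gbinomial_diff (of_nat q) k * \<rho> j k))"
    using basis by simp
  also have "\<dots> = (\<Sum>j\<le>a. \<Sum>k\<le>a. gbinomial_diff (of_nat q) k * (c j * \<rho> j k))"
    by (simp add: sum_distrib_left algebra_simps)
  also have "\<dots> = (\<Sum>k\<le>a. gbinomial_diff (of_nat q) k * \<mu> k)"
    by (subst sum.swap) (simp add: \<mu> sum_distrib_left)
  finally show ?case .
qed

section \<open>Colourings of a cycle as closed walks of disjoint sets\<close>

section \<open>Multicolorings of the cycle\<close>

(* A sits at vertex 1 and B at vertex j + 1; the size of B is not constrained. *)
primrec disjoint_walks :: "(nat \<Rightarrow> nat) \<Rightarrow> nat set \<Rightarrow> nat \<Rightarrow> nat set \<Rightarrow> nat set \<Rightarrow> rat" where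
  "disjoint_walks m X 0 A B = of_bool (A = B)"
| "disjoint_walks m X (Suc j) A B =
     (\<Sum>C\<in>subsets_of_card X (m (Suc j)). disjoint_walks m X j A C * of_bool (C \<inter> B = {}))"

text \<open>A permutation of \<open>X\<close> can be applied to every intermediate set of a walk and
  preserves disjointness.\<close>

lemma invariant_kernel_disjoint_walks: "invariant_kernel X (disjoint_walks m X j)"
proof (induction j)
  case 0
  show ?case
    unfolding invariant_kernel_def by (auto simp: bij_betw_def inj_on_image_eq_iff)
next
  case (Suc j)
  show ?case
    unfolding invariant_kernel_def
  proof (intro allI impI)
    fix \<sigma> A B assume \<sigma>: "bij_betw \<sigma> X X" and AB: "A \<subseteq> X" "B \<subseteq> X"
    have "disjoint_walks m X (Suc j) (\<sigma> ` A) (\<sigma> ` B) =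
        (\<Sum>C\<in>subsets_of_card X (m (Suc j)).
          disjoint_walks m X j (\<sigma> ` A) (\<sigma> ` C) * of_bool (\<sigma> ` C \<inter> \<sigma> ` B = {}))"
      by (simp only: disjoint_walks.simps sum_subsets_of_card_image[OF \<sigma>,
          of "\<lambda>C. disjoint_walks m X j (\<sigma> ` A) C * of_bool (C \<inter> \<sigma> ` B = {})"])
    also have "\<dots> = disjoint_walks m X (Suc j) A B"
      unfolding disjoint_walks.simps
    proof (intro sum.cong refl)
      fix C assume "C \<in> subsets_of_card X (m (Suc j))"
      hence C: "C \<subseteq> X" by (simp add: subsets_of_card_def)
      have "\<sigma> ` C \<inter> \<sigma> ` B = \<sigma> ` (C \<inter> B)"
        using \<sigma> C AB by (intro inj_on_image_Int[symmetric, of _ X]) (auto simp: bij_betw_def)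
      thus "disjoint_walks m X j (\<sigma> ` A) (\<sigma> ` C) * of_bool (\<sigma> ` C \<inter> \<sigma> ` B = {}) =
          disjoint_walks m X j A C * of_bool (C \<inter> B = {})"
        using invariant_kernel_image[OF Suc.IH \<sigma> AB(1) C] by simp
    qed
    finally show "disjoint_walks m X (Suc j) (\<sigma> ` A) (\<sigma> ` B) = disjoint_walks m X (Suc j) A B" .
  qed
qed

text \<open>One step from \<open>C\<close> sums \<open>alternating k\<close> over subsets of
  \<open>X - C\<close>: \<open>sum_alternating\<close> contributes the binomial coefficient and
  complementing \<open>C\<close> the sign. The result is again a multiple of the test vector, so the
  factors of successive steps multiply.\<close>

lemma disjoint_walks_alternating:
  fixes q :: nat
  defines "X \<equiv> {1..q}"
  assumes "A \<in> subsets_of_card X (m 1)" "2 * k \<le> q"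
  shows "(\<Sum>B\<in>subsets_of_card X (m (Suc j)). disjoint_walks m X j A B * alternating k B) =
         (\<Prod>i=1..j. if k \<le> m (Suc i)
            then (- 1) ^ k * of_nat ((q - m i - k) choose (m (Suc i) - k)) else 0) * alternating k A"
proof (induction j)
  case 0
  have "(\<Sum>B\<in>subsets_of_card X (m (Suc 0)). disjoint_walks m X 0 A B * alternating k B) =
      (\<Sum>B\<in>{A}. alternating k B)"
    using assms by (intro sum.mono_neutral_cong_right) (auto simp: X_def)
  thus ?case by simp
next
  case (Suc j)
  have [simp]: "finite X" by (simp add: X_def)
  define w where "w = (if k \<le> m (Suc (Suc j))
    then (- 1) ^ k * of_nat ((q - m (Suc j) - k) choose (m (Suc (Suc j)) - k)) else (0 :: rat))"
  have step: "(\<Sum>B\<in>subsets_of_card X (m (Suc (Suc j))). of_bool (C \<inter> B = {}) * alternating k B) =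
      w * alternating k C" if "C \<in> subsets_of_card X (m (Suc j))" for C
  proof -
    have C: "C \<subseteq> X" "card C = m (Suc j)" "finite C"
      using that finite_subset[of C X] by (auto simp: subsets_of_card_def)
    have "(\<Sum>B\<in>subsets_of_card X (m (Suc (Suc j))). of_bool (C \<inter> B = {}) * alternating k B) =
        (\<Sum>B\<in>subsets_of_card (X - C) (m (Suc (Suc j))). alternating k B)"
      by (intro sum.mono_neutral_cong_right) (auto simp: subsets_of_card_def)
    also have "\<dots> = w * alternating k C"
      using C assms(3) alternating_complement[of k q C]
      by (simp add: sum_alternating card_Diff_subset w_def) (simp add: X_def)
    finally show ?thesis .
  qed
  have "(\<Sum>B\<in>subsets_of_card X (m (Suc (Suc j))). disjoint_walks m X (Suc j) A B * alternating k B) =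
      (\<Sum>B\<in>subsets_of_card X (m (Suc (Suc j))). \<Sum>C\<in>subsets_of_card X (m (Suc j)).
        disjoint_walks m X j A C * (of_bool (C \<inter> B = {}) * alternating k B))"
    by (simp only: disjoint_walks.simps sum_distrib_right mult.assoc)
  also have "\<dots> = (\<Sum>C\<in>subsets_of_card X (m (Suc j)). disjoint_walks m X j A C *
      (\<Sum>B\<in>subsets_of_card X (m (Suc (Suc j))). of_bool (C \<inter> B = {}) * alternating k B))"
    by (subst sum.swap) (simp only: sum_distrib_left)
  also have "\<dots> = (\<Sum>C\<in>subsets_of_card X (m (Suc j)). w * (disjoint_walks m X j A C * alternating k C))"
    by (intro sum.cong refl) (simp only: step, simp)
  also have "\<dots> = w * (\<Sum>C\<in>subsets_of_card X (m (Suc j)). disjoint_walks m X j A C * alternating k C)"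
    by (simp only: sum_distrib_left)
  finally show ?case
    unfolding Suc.IH by (simp add: w_def mult_ac)
qed

text \<open>The recursion unfolded into tuples. The endpoint \<open>B\<close> is kept outside the
  tuple so that it can later be identified with \<open>A\<close>.\<close>

lemma disjoint_walks_expand:
  assumes "finite X" "A \<in> subsets_of_card X (m 1)" "j \<ge> 1"
  shows "disjoint_walks m X j A B =
    (\<Sum>\<tau>\<in>(\<Pi>\<^sub>E i\<in>{1..j}. subsets_of_card X (m i)).
       of_bool (\<tau> 1 = A \<and> (\<forall>i\<in>{1..<j}. \<tau> i \<inter> \<tau> (Suc i) = {}) \<and> \<tau> j \<inter> B = {}))"
  using assms(3)
proof (induction j arbitrary: B rule: dec_induct)
  case base
  have "disjoint_walks m X 1 A B = (\<Sum>C\<in>subsets_of_card X (m 1). of_bool (C = A \<and> C \<inter> B = {}))"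
    by (auto intro!: sum.cong)
  also have "\<dots> = (\<Sum>\<tau>\<in>(\<Pi>\<^sub>E i\<in>{1..1}. subsets_of_card X (m i)). of_bool (\<tau> 1 = A \<and> \<tau> 1 \<inter> B = {}))"
    by (rule sum.reindex_bij_witness[where j = "\<lambda>C. \<lambda>i\<in>{1}. C" and i = "\<lambda>\<tau>. \<tau> 1"])
       (auto simp: PiE_def extensional_def fun_eq_iff)
  finally show ?case by simp
next
  case (step j)
  let ?P = "\<lambda>j B \<tau>. \<tau> 1 = A \<and> (\<forall>i\<in>{1..<j}. \<tau> i \<inter> \<tau> (Suc i) = {}) \<and> \<tau> j \<inter> B = {}"
  let ?S = "\<lambda>i. subsets_of_card X (m i)"
  have ins: "{1..Suc j} = insert (Suc j) {1..j}"
    using step.hyps by auto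
  have "disjoint_walks m X (Suc j) A B =
      (\<Sum>C\<in>?S (Suc j). \<Sum>\<tau>\<in>(\<Pi>\<^sub>E i\<in>{1..j}. ?S i). of_bool (?P j C \<tau>) * of_bool (C \<inter> B = {}))"
    by (simp only: disjoint_walks.simps step.IH sum_distrib_right)
  \<comment> \<open>The endpoint \<open>C\<close> of the shorter walk becomes the entry of the tuple
    at \<open>Suc j\<close>.\<close>
  also have "\<dots> = (\<Sum>(C, \<tau>)\<in>?S (Suc j) \<times> (\<Pi>\<^sub>E i\<in>{1..j}. ?S i). of_bool (?P (Suc j) B (\<tau>(Suc j := C))))"
  proof -
    have "{1..<Suc j} = insert j {1..<j}" using step.hyps by auto
    hence "?P (Suc j) B (\<tau>(Suc j := C)) \<longleftrightarrow> ?P j C \<tau> \<and> C \<inter> B = {}" for C \<tau>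
      using step.hyps by auto
    thus ?thesis by (simp only: of_bool_conj sum.cartesian_product)
  qed
  also have "\<dots> = (\<Sum>\<tau>\<in>(\<Pi>\<^sub>E i\<in>{1..Suc j}. ?S i). of_bool (?P (Suc j) B \<tau>))"
    unfolding ins PiE_insert_eq
    by (subst sum.reindex[OF inj_combinator]) (auto simp: case_prod_unfold)
  finally show ?case .
qed

text \<open>Closing the walk turns its last disjointness condition into the one for the edge between
  n and 1; the sum over \<open>A\<close> merely names \<open>\<tau> 1\<close>.\<close>

lemma of_nat_card_multicolorings_cycle:
  assumes "n \<ge> 3"
  shows "of_nat (card (multicolorings (cycle_graph n) m {1..q})) =
    (\<Sum>A\<in>subsets_of_card {1..q} (m 1). disjoint_walks m {1..q} n A A)"
proof -
  let ?X = "{1..q}"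
  let ?T = "\<Pi>\<^sub>E i\<in>{1..n}. subsets_of_card ?X (m i)"
  let ?P = "\<lambda>\<tau>. (\<forall>i\<in>{1..<n}. \<tau> i \<inter> \<tau> (Suc i) = {}) \<and> \<tau> n \<inter> \<tau> 1 = {}"
  have "(\<Sum>A\<in>subsets_of_card ?X (m 1). disjoint_walks m ?X n A A) =
      (\<Sum>A\<in>subsets_of_card ?X (m 1). \<Sum>\<tau>\<in>?T. of_bool (\<tau> 1 = A) * of_bool (?P \<tau>))"
    using assms
    by (intro sum.cong refl, subst disjoint_walks_expand)
       (auto simp del: One_nat_def simp flip: of_bool_conj intro!: sum.cong)
  also have "\<dots> = (\<Sum>\<tau>\<in>?T. \<Sum>A\<in>subsets_of_card ?X (m 1). of_bool (\<tau> 1 = A) * of_bool (?P \<tau>))"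
    by (rule sum.swap)
  also have "\<dots> = (\<Sum>\<tau>\<in>?T. of_bool (?P \<tau>))"
  proof (intro sum.cong refl)
    fix \<tau> assume "\<tau> \<in> ?T"
    hence "\<tau> 1 \<in> subsets_of_card ?X (m 1)"
      using assms by (auto simp: PiE_iff simp del: One_nat_def)
    hence "(\<Sum>A\<in>subsets_of_card ?X (m 1). of_bool (\<tau> 1 = A) * of_bool (?P \<tau>)) =
        (\<Sum>A\<in>{\<tau> 1}. of_bool (?P \<tau>) :: rat)"
      by (intro sum.mono_neutral_cong_right) auto
    thus "(\<Sum>A\<in>subsets_of_card ?X (m 1). of_bool (\<tau> 1 = A) * of_bool (?P \<tau>)) =
        (of_bool (?P \<tau>) :: rat)" by simp
  qed
  also have "\<dots> = of_nat (card {\<tau> \<in> ?T. ?P \<tau>})"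
    by (subst sum_of_bool_eq) (auto simp: Int_def intro!: finite_PiE)
  also have "{\<tau> \<in> ?T. ?P \<tau>} = multicolorings (cycle_graph n) m ?X"
  proof -
    have mod: "i mod n = (if i = n then 0 else i)" if "i \<in> {1..n}" for i
      using that by auto
    have edges: "(\<forall>(i, j)\<in>parcs (cycle_graph n). \<tau> i \<inter> \<tau> j = {}) \<longleftrightarrow> ?P \<tau>" for \<tau> :: "nat \<Rightarrow> nat set"
    proof -
      \<comment> \<open>Disjointness is symmetric, so one orientation of each edge suffices.\<close>
      have "(\<forall>(i, j)\<in>parcs (cycle_graph n). \<tau> i \<inter> \<tau> j = {}) \<longleftrightarrow>
          (\<forall>i\<in>{1..n}. \<tau> i \<inter> \<tau> (i mod n + 1) = {})"
      proof (intro iffI ballI)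
        fix i assume i: "i \<in> {1..n}" and disj: "\<forall>(i, j)\<in>parcs (cycle_graph n). \<tau> i \<inter> \<tau> j = {}"
        have "(i, i mod n + 1) \<in> parcs (cycle_graph n)"
          using i by (auto simp: cycle_graph_def mod)
        thus "\<tau> i \<inter> \<tau> (i mod n + 1) = {}" using disj by blast
      next
        fix e assume "e \<in> parcs (cycle_graph n)" and "\<forall>i\<in>{1..n}. \<tau> i \<inter> \<tau> (i mod n + 1) = {}"
        thus "case e of (i, j) \<Rightarrow> \<tau> i \<inter> \<tau> j = {}"
          by (cases e) (simp add: cycle_graph_def del: atLeastAtMost_iff, metis Int_commute)
      qed
      also have "{1..n} = insert n {1..<n}" using assms by auto
      finally show ?thesis by auto
    qed
    show ?thesis
      unfolding multicolorings_def edges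
      by (auto simp: cycle_graph_def subsets_of_card_def PiE_iff)
  qed
  finally show ?thesis by simp
qed

lemma card_multicolorings_cycle:
  assumes "n \<ge> 3" "2 * m 1 \<le> q"
  shows "of_nat (card (multicolorings (cycle_graph n) m {1..q})) =
    (\<Sum>k\<le>m 1. gbinomial_diff (of_nat q) k * (\<Prod>i=1..n. if k \<le> m (i mod n + 1)
       then (- 1) ^ k * of_nat ((q - m i - k) choose (m (i mod n + 1) - k)) else 0 :: rat))"
proof -
  \<comment> \<open>A closed walk of n steps ends at index n + 1, where \<open>m'\<close> repeats
    the value at 1, so that the walk returns to the level on which the trace is taken.\<close>
  define m' where "m' = m(Suc n := m 1)"
  have m': "m' 1 = m 1" "m' (Suc n) = m 1" using assms by (auto simp: m'_def)
  have "multicolorings (cycle_graph n) m {1..q} = multicolorings (cycle_graph n) m' {1..q}"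
    unfolding multicolorings_def by (auto simp: m'_def cycle_graph_def)
  also have "of_nat (card \<dots>) = (\<Sum>A\<in>subsets_of_card {1..q} (m 1). disjoint_walks m' {1..q} n A A)"
    using of_nat_card_multicolorings_cycle[OF assms(1), of m' q] by (simp only: m')
  also have "\<dots> = (\<Sum>k\<le>m 1. gbinomial_diff (of_nat q) k * (\<Prod>i=1..n. if k \<le> m' (Suc i)
       then (- 1) ^ k * of_nat ((q - m' i - k) choose (m' (Suc i) - k)) else 0))"
  proof (rule trace_invariant_kernel[where F = "disjoint_walks m' {1..q} n"])
    fix k A assume "k \<le> m 1" "A \<in> subsets_of_card {1..q} (m 1)"
    thus "(\<Sum>B\<in>subsets_of_card {1..q} (m 1). disjoint_walks m' {1..q} n A B * alternating k B) =
      (\<Prod>i=1..n. if k \<le> m' (Suc i)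
       then (- 1) ^ k * of_nat ((q - m' i - k) choose (m' (Suc i) - k)) else 0) * alternating k A"
      using disjoint_walks_alternating[of A q m' k n] assms(2) m' by (simp only: m')
  qed (use assms invariant_kernel_disjoint_walks in auto)
  also have "\<dots> = (\<Sum>k\<le>m 1. gbinomial_diff (of_nat q) k * (\<Prod>i=1..n. if k \<le> m (i mod n + 1)
       then (- 1) ^ k * of_nat ((q - m i - k) choose (m (i mod n + 1) - k)) else 0))"
  proof (intro sum.cong prod.cong refl arg_cong2[of _ _ _ _ "(*)"])
    fix k i assume "i \<in> {1..n}"
    moreover from this have "m' (Suc i) = m (i mod n + 1)"
      by (cases "i = n") (auto simp: m'_def)
    moreover have "m' i = m i" using \<open>i \<in> {1..n}\<close> by (auto simp: m'_def)
    ultimately show "(if k \<le> m' (Suc i)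
       then (- 1) ^ k * of_nat ((q - m' i - k) choose (m' (Suc i) - k)) else 0) =
      (if k \<le> m (i mod n + 1)
       then (- 1) ^ k * of_nat ((q - m i - k) choose (m (i mod n + 1) - k)) else (0 :: rat))"
      by simp
  qed
  finally show ?thesis .
qed

section \<open>Negative powers of the independence series of any finite graph\<close>

section \<open>Powers of the independence series\<close>

text \<open>A predicate on functions, so that closure rules handle expressions with
  \<open>gchoose\<close> without exhibiting a polynomial.\<close>

definition is_polynomial :: "(rat \<Rightarrow> rat) \<Rightarrow> bool" where
  "is_polynomial f \<longleftrightarrow> (\<exists>p. \<forall>z. f z = poly p z)"

lemma is_polynomial_poly [intro]: "is_polynomial (poly p)"
  by (auto simp: is_polynomial_def)

lemma is_polynomial_const [intro]: "is_polynomial (\<lambda>_. c)"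
  by (auto simp: is_polynomial_def intro: exI[of _ "[:c:]"])

lemma is_polynomial_ident [intro]: "is_polynomial (\<lambda>z. z)"
  by (auto simp: is_polynomial_def intro: exI[of _ "[:0, 1:]"])

lemma is_polynomial_add [intro]:
  "is_polynomial f \<Longrightarrow> is_polynomial g \<Longrightarrow> is_polynomial (\<lambda>z. f z + g z)"
  unfolding is_polynomial_def by (metis poly_add)

lemma is_polynomial_diff [intro]:
  "is_polynomial f \<Longrightarrow> is_polynomial g \<Longrightarrow> is_polynomial (\<lambda>z. f z - g z)"
  unfolding is_polynomial_def by (metis poly_diff)

lemma is_polynomial_mult [intro]:
  "is_polynomial f \<Longrightarrow> is_polynomial g \<Longrightarrow> is_polynomial (\<lambda>z. f z * g z)"
  unfolding is_polynomial_def by (metis poly_mult)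

lemma is_polynomial_compose:
  "is_polynomial f \<Longrightarrow> is_polynomial g \<Longrightarrow> is_polynomial (\<lambda>z. f (g z))"
  unfolding is_polynomial_def by (metis poly_pcompose)

lemma is_polynomial_sum [intro]:
  "(\<And>x. x \<in> A \<Longrightarrow> is_polynomial (f x)) \<Longrightarrow> is_polynomial (\<lambda>z. \<Sum>x\<in>A. f x z)"
  by (induction A rule: infinite_finite_induct) auto

lemma is_polynomial_prod [intro]:
  "(\<And>x. x \<in> A \<Longrightarrow> is_polynomial (f x)) \<Longrightarrow> is_polynomial (\<lambda>z. \<Prod>x\<in>A. f x z)"
  by (induction A rule: infinite_finite_induct) auto

lemma is_polynomial_gbinomial: "is_polynomial f \<Longrightarrow> is_polynomial (\<lambda>z. f z gchoose k)"
  unfolding gbinomial_prod_rev divide_inverse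
  by (intro is_polynomial_mult is_polynomial_prod is_polynomial_diff is_polynomial_const)

lemma is_polynomial_gbinomial_diff: "is_polynomial (\<lambda>z. gbinomial_diff z k)"
  unfolding gbinomial_diff_def
  by (cases "k = 0") (auto intro!: is_polynomial_gbinomial)

text \<open>Otherwise the difference would have infinitely many roots. The threshold
  \<open>N\<close> admits identities established only for large arguments.\<close>

lemma is_polynomial_eqI:
  assumes "is_polynomial f" "is_polynomial g" "\<And>r. r \<ge> N \<Longrightarrow> f (of_nat r) = g (of_nat r)"
  shows "f z = g z"
proof -
  obtain p p' where p: "\<And>z. f z = poly p z" "\<And>z. g z = poly p' z"
    using assms(1,2) by (auto simp: is_polynomial_def)
  have "p - p' = 0"
  proof (rule ccontr)
    assume "p - p' \<noteq> 0"
    hence "finite {x. poly (p - p') x = 0}" by (rule poly_roots_finite)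
    moreover have "of_nat ` {N..} \<subseteq> {x. poly (p - p') x = 0}" using assms(3) p by auto
    ultimately have "finite (of_nat ` {N..} :: rat set)" by (rule finite_subset[rotated])
    thus False by (simp add: finite_image_iff inj_on_def infinite_Ici)
  qed
  thus ?thesis using p by simp
qed

section \<open>Multiplication by monomials and removal of one colour\<close>

lemma mfps_coeff_var_mult:
  "mfps_coeff (mfps_var i * g) m =
     (if Poly_Mapping.lookup m i > 0 then mfps_coeff g (m - Poly_Mapping.single i 1) else 0)"
proof (cases "Poly_Mapping.lookup m i > 0")
  case True
  hence split: "Poly_Mapping.single i 1 + (m - Poly_Mapping.single i 1) = m"
    by (intro poly_mapping_eqI) (auto simp: lookup_add lookup_minus lookup_single when_def)
  have "mfps_coeff (mfps_var i * g) m =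
      (\<Sum>(a, b)\<in>{(Poly_Mapping.single i 1, m - Poly_Mapping.single i 1)}.
        mfps_coeff (mfps_var i) a * mfps_coeff g b)"
    unfolding mfps_coeff_mult
  proof (rule sum.mono_neutral_right)
    show "\<forall>x\<in>splits m - {(Poly_Mapping.single i 1, m - Poly_Mapping.single i 1)}.
        (case x of (a, b) \<Rightarrow> mfps_coeff (mfps_var i) a * mfps_coeff g b) = 0"
      by (auto simp: splits_def mfps_var_def split: if_splits)
    show "finite (splits m)" by (fact finite_splits)
  qed (use split in \<open>auto simp: splits_def\<close>)
  thus ?thesis using True by (simp add: mfps_var_def)
next
  case False
  hence "a \<noteq> Poly_Mapping.single i 1" if "a + b = m" for a b
    using that by (auto simp: lookup_add)
  thus ?thesis using False
    by (auto simp: mfps_coeff_mult splits_def mfps_var_def intro!: sum.neutral)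
qed

lemma mfps_coeff_prod_var_mult:
  assumes "finite S"
  shows "mfps_coeff ((\<Prod>i\<in>S. mfps_var i) * g) m =
    (if \<forall>i\<in>S. Poly_Mapping.lookup m i > 0 then mfps_coeff g (m - exponent S (\<lambda>_. 1)) else 0)"
  using assms
proof (induction S arbitrary: m rule: finite_induct)
  case empty
  thus ?case by (simp add: exponent_def)
next
  case (insert i S)
  have "Poly_Mapping.lookup (m - Poly_Mapping.single i 1) j = Poly_Mapping.lookup m j" if "j \<in> S" for j
    using insert.hyps that by (auto simp: lookup_minus lookup_single when_def)
  moreover have "m - Poly_Mapping.single i 1 - exponent S (\<lambda>_. 1) = m - exponent (insert i S) (\<lambda>_. 1)"
    using insert.hyps by (simp add: exponent_def diff_diff_add)
  ultimately show ?case
    using insert by (auto simp: mult.assoc mfps_coeff_var_mult)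
qed

lemma multicolorings_cong:
  "(\<And>i. i \<in> pverts G \<Longrightarrow> m i = m' i) \<Longrightarrow> multicolorings G m P = multicolorings G m' P"
  unfolding multicolorings_def by auto

lemma gen_chromatic_poly_cong:
  "(\<And>i. i \<in> pverts G \<Longrightarrow> m i = m' i) \<Longrightarrow> gen_chromatic_poly G m = gen_chromatic_poly G m'"
  unfolding gen_chromatic_poly_def using multicolorings_cong[of G m m'] by simp

text \<open>Deleting \<open>c\<close> from all sets is inverted by reinserting it on
  \<open>S\<close>. Independence of \<open>S\<close> keeps adjacent sets disjoint on reinsertion,
  and positivity makes the truncated subtraction a true predecessor.\<close>

lemma card_multicolorings_color_class:
  assumes "pair_wf_digraph G" "finite P" "c \<notin> P" "S \<in> independent_sets G"
  shows "card {\<tau> \<in> multicolorings G m (insert c P). {i \<in> pverts G. c \<in> \<tau> i} = S} =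
    (if \<forall>i\<in>S. m i > 0 then card (multicolorings G (\<lambda>i. m i - of_bool (i \<in> S)) P) else 0)"
    (is "card ?F = _")
proof -
  interpret pair_wf_digraph G by (rule assms(1))
  have S: "S \<subseteq> pverts G" "\<And>i j. i \<in> S \<Longrightarrow> j \<in> S \<Longrightarrow> (i, j) \<notin> parcs G"
    using assms(4) by (auto simp: independent_sets_def)
  have fin: "finite A" if "A \<subseteq> insert c P" for A
    using that assms(2) by (meson finite_insert finite_subset)
  show ?thesis
  proof (cases "\<forall>i\<in>S. m i > 0")
    case False
    then obtain i where i: "i \<in> S" "m i = 0" by auto
    have "?F = {}"
    proof (rule equals0I)
      fix \<tau> assume \<tau>: "\<tau> \<in> ?F"
      hence "card (\<tau> i) = 0" "\<tau> i \<subseteq> insert c P" using i S(1) by (auto simp: multicolorings_def)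
      hence "\<tau> i = {}" using fin by auto
      thus False using \<tau> i by auto
    qed
    thus ?thesis using False by (simp only: card.empty if_False)
  next
    case True
    have "bij_betw (\<lambda>\<tau>. \<lambda>i\<in>pverts G. \<tau> i - {c}) ?F
        (multicolorings G (\<lambda>i. m i - of_bool (i \<in> S)) P)"
    proof (rule bij_betw_byWitness[where
          f' = "\<lambda>\<tau>. \<lambda>i\<in>pverts G. if i \<in> S then insert c (\<tau> i) else \<tau> i"])
      show "\<forall>\<tau>\<in>?F. (\<lambda>i\<in>pverts G. if i \<in> S then insert c ((\<lambda>i\<in>pverts G. \<tau> i - {c}) i)
          else (\<lambda>i\<in>pverts G. \<tau> i - {c}) i) = \<tau>"
        by (auto simp: multicolorings_def fun_eq_iff PiE_def extensional_def restrict_def)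
      show "\<forall>\<tau>\<in>multicolorings G (\<lambda>i. m i - of_bool (i \<in> S)) P. (\<lambda>i\<in>pverts G.
          (\<lambda>i\<in>pverts G. if i \<in> S then insert c (\<tau> i) else \<tau> i) i - {c}) = \<tau>"
      proof
        fix \<tau> assume \<tau>: "\<tau> \<in> multicolorings G (\<lambda>i. m i - of_bool (i \<in> S)) P"
        hence "c \<notin> \<tau> i" if "i \<in> pverts G" for i
          using that assms(3) by (auto simp: multicolorings_def)
        thus "(\<lambda>i\<in>pverts G. (\<lambda>i\<in>pverts G. if i \<in> S then insert c (\<tau> i) else \<tau> i) i - {c}) = \<tau>"
          using \<tau> by (auto simp: multicolorings_def fun_eq_iff PiE_def extensional_def restrict_def)
      qed
      show "(\<lambda>\<tau>. \<lambda>i\<in>pverts G. \<tau> i - {c}) ` ?F \<subseteq> multicolorings G (\<lambda>i. m i - of_bool (i \<in> S)) P"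
      proof (rule image_subsetI)
        fix \<tau> assume \<tau>: "\<tau> \<in> ?F"
        have "card (\<tau> i - {c}) = m i - of_bool (i \<in> S)" if "i \<in> pverts G" for i
          using \<tau> that by (auto simp: multicolorings_def card_Diff_singleton_if)
        thus "(\<lambda>i\<in>pverts G. \<tau> i - {c}) \<in> multicolorings G (\<lambda>i. m i - of_bool (i \<in> S)) P"
          using \<tau> wellformed' by (fastforce simp: multicolorings_def)
      qed
      show "(\<lambda>\<tau>. \<lambda>i\<in>pverts G. if i \<in> S then insert c (\<tau> i) else \<tau> i) `
          multicolorings G (\<lambda>i. m i - of_bool (i \<in> S)) P \<subseteq> ?F"
      proof (rule image_subsetI)
        fix \<tau> assume \<tau>: "\<tau> \<in> multicolorings G (\<lambda>i. m i - of_bool (i \<in> S)) P"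
        let ?\<tau> = "\<lambda>i\<in>pverts G. if i \<in> S then insert c (\<tau> i) else \<tau> i"
        have sub: "\<tau> i \<subseteq> P" if "i \<in> pverts G" for i
          using \<tau> that by (auto simp: multicolorings_def)
        have c: "c \<notin> \<tau> i" if "i \<in> pverts G" for i
          using sub that assms(3) by blast
        have card: "card (?\<tau> i) = m i" if "i \<in> pverts G" for i
        proof -
          have "finite (\<tau> i)" using sub[OF that] assms(2) by (rule finite_subset)
          moreover have "card (\<tau> i) = m i - of_bool (i \<in> S)"
            using \<tau> that by (auto simp: multicolorings_def)
          ultimately show ?thesis using that c True by auto
        qed
        have disj: "?\<tau> i \<inter> ?\<tau> j = {}" if "(i, j) \<in> parcs G" for i j
        proof -
          have "i \<in> pverts G" "j \<in> pverts G" using wellformed'[OF that] by auto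
          moreover have "\<tau> i \<inter> \<tau> j = {}" using \<tau> that by (auto simp: multicolorings_def)
          ultimately show ?thesis using c S(2)[of i j] that by auto
        qed
        have "?\<tau> \<in> pverts G \<rightarrow>\<^sub>E Pow (insert c P)"
          using sub by (fastforce split: if_splits)
        moreover have "{i \<in> pverts G. c \<in> ?\<tau> i} = S" using c S(1) by auto
        moreover have "\<forall>(i, j)\<in>parcs G. ?\<tau> i \<inter> ?\<tau> j = {}" using disj by blast
        ultimately show "?\<tau> \<in> ?F"
          unfolding multicolorings_def mem_Collect_eq using card by blast
      qed
    qed
    thus ?thesis using True bij_betw_same_card by auto
  qed
qed

text \<open>Colourings are grouped by the vertices that use \<open>c\<close>, an independent set.
  The recursion mirrors multiplication by \<open>independence_series G\<close>.\<close>

lemma card_multicolorings_insert: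
  assumes "pair_graph G" "finite P" "c \<notin> P"
  shows "card (multicolorings G m (insert c P)) = (\<Sum>S\<in>independent_sets G.
    if \<forall>i\<in>S. m i > 0 then card (multicolorings G (\<lambda>i. m i - of_bool (i \<in> S)) P) else 0)"
proof -
  interpret pair_graph G by (rule assms(1))
  have fin: "finite (multicolorings G m (insert c P))"
    by (rule finite_subset[of _ "pverts G \<rightarrow>\<^sub>E Pow (insert c P)"])
       (auto simp: multicolorings_def assms(2) intro!: finite_PiE)
  have "card (multicolorings G m (insert c P)) = (\<Sum>S\<in>independent_sets G.
      card {\<tau> \<in> multicolorings G m (insert c P). {i \<in> pverts G. c \<in> \<tau> i} = S})"
    unfolding card_eq_sum
  proof (rule sum.group[symmetric, OF fin])
    show "finite (independent_sets G)"
      by (rule finite_subset[of _ "Pow (pverts G)"]) (auto simp: independent_sets_def)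
    show "(\<lambda>\<tau>. {i \<in> pverts G. c \<in> \<tau> i}) ` multicolorings G m (insert c P) \<subseteq> independent_sets G"
      by (fastforce simp: independent_sets_def multicolorings_def)
  qed
  thus ?thesis
    using assms card_multicolorings_color_class[OF pair_wf_digraph_axioms] by simp
qed

text \<open>The argument is rational so that -q can be inserted. The guard is there because
  \<open>gen_chromatic_poly G\<close> ignores exponents outside \<open>pverts G\<close>, while
  powers of the independence series involve only the variables of the graph.\<close>

definition chromatic_series :: "'i pair_pre_digraph \<Rightarrow> rat \<Rightarrow> ('i, rat) mfps" where
  "chromatic_series G z = Abs_mfps (\<lambda>m. if Poly_Mapping.keys m \<subseteq> pverts G
     then poly (gen_chromatic_poly G (Poly_Mapping.lookup m)) z else 0)"

lemma mfps_coeff_independence_series_mult: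
  assumes "pair_graph G"
  shows "mfps_coeff (independence_series G * g) m = (\<Sum>S\<in>independent_sets G.
    if \<forall>i\<in>S. Poly_Mapping.lookup m i > 0 then mfps_coeff g (m - exponent S (\<lambda>_. 1)) else 0)"
proof -
  interpret pair_graph G by (rule assms)
  have "finite S" if "S \<in> independent_sets G" for S
    using that pair_finite_verts by (auto simp: independent_sets_def intro: finite_subset)
  thus ?thesis
    unfolding independence_series_def by (simp add: sum_distrib_right mfps_coeff_prod_var_mult)
qed

text \<open>Without colours only the zero exponent admits a colouring; each further colour
  multiplies by the independence series.\<close>

lemma chromatic_series_of_nat:
  assumes "pair_graph G"
  shows "chromatic_series G (of_nat q) = independence_series G ^ q"
proof (induction q)
  case 0
  interpret pair_graph G by (rule assms)
  show ?case
  proof (rule mfps_eqI)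
    fix m :: "'a \<Rightarrow>\<^sub>0 nat"
    have "multicolorings G (Poly_Mapping.lookup m) {} = (if m = 0 then {\<lambda>i\<in>pverts G. {}} else {})"
      if "Poly_Mapping.keys m \<subseteq> pverts G"
    proof (cases "m = 0")
      case True
      thus ?thesis
        by (auto simp: multicolorings_def PiE_def extensional_def fun_eq_iff
            dest: wellformed' split: if_splits)
    next
      case False
      then obtain i where "Poly_Mapping.lookup m i \<noteq> 0"
        by (metis lookup_zero poly_mapping_eqI)
      moreover from this have "i \<in> pverts G" using that by (auto simp: in_keys_iff)
      ultimately show ?thesis using False by (fastforce simp: multicolorings_def)
    qed
    thus "mfps_coeff (chromatic_series G (of_nat 0)) m = mfps_coeff (independence_series G ^ 0) m"
      using poly_gen_chromatic_poly[OF assms, of "Poly_Mapping.lookup m" 0]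
      by (auto simp: chromatic_series_def mfps_coeff_one)
  qed
next
  case (Suc q)
  interpret pair_graph G by (rule assms)
  show ?case
  proof (rule mfps_eqI)
    fix m :: "'a \<Rightarrow>\<^sub>0 nat"
    let ?m = "Poly_Mapping.lookup m"
    have coeff: "mfps_coeff (chromatic_series G (of_nat q)) (m - exponent S (\<lambda>_. 1)) =
        (if Poly_Mapping.keys m \<subseteq> pverts G
         then of_nat (card (multicolorings G (\<lambda>i. ?m i - of_bool (i \<in> S)) {1..q})) else 0)"
      if S: "S \<in> independent_sets G" and pos: "\<forall>i\<in>S. ?m i > 0" for S
    proof -
      have "S \<subseteq> pverts G" using S by (auto simp: independent_sets_def)
      moreover from this have "finite S" using pair_finite_verts by (rule finite_subset)
      hence l: "Poly_Mapping.lookup (m - exponent S (\<lambda>_. 1)) = (\<lambda>i. ?m i - of_bool (i \<in> S))"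
        by (auto simp: fun_eq_iff lookup_minus lookup_exponent)
      ultimately have "Poly_Mapping.keys (m - exponent S (\<lambda>_. 1)) \<subseteq> pverts G \<longleftrightarrow>
          Poly_Mapping.keys m \<subseteq> pverts G"
        by (auto simp: subset_iff in_keys_iff split: if_splits)
      thus ?thesis
        by (simp add: chromatic_series_def l del: One_nat_def add: poly_gen_chromatic_poly[OF assms])
    qed
    have "mfps_coeff (independence_series G ^ Suc q) m = (\<Sum>S\<in>independent_sets G.
        if \<forall>i\<in>S. ?m i > 0
        then mfps_coeff (chromatic_series G (of_nat q)) (m - exponent S (\<lambda>_. 1)) else 0)"
      by (simp add: mfps_coeff_independence_series_mult[OF assms] Suc.IH cong: if_cong)
    also have "\<dots> = (\<Sum>S\<in>independent_sets G.
        if \<forall>i\<in>S. ?m i > 0 then if Poly_Mapping.keys m \<subseteq> pverts G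
         then of_nat (card (multicolorings G (\<lambda>i. ?m i - of_bool (i \<in> S)) {1..q})) else 0 else 0)"
      using coeff by (intro sum.cong refl) (auto simp del: One_nat_def)
    also have "\<dots> = (if Poly_Mapping.keys m \<subseteq> pverts G
        then of_nat (card (multicolorings G ?m (insert (Suc q) {1..q}))) else 0)"
      by (simp add: card_multicolorings_insert[OF assms] if_distrib[of of_nat]
          del: One_nat_def cong: if_cong)
    also have "insert (Suc q) {1..q} = {1..Suc q}" by auto
    also have "(if Poly_Mapping.keys m \<subseteq> pverts G
        then of_nat (card (multicolorings G ?m {1..Suc q})) else 0) =
        mfps_coeff (chromatic_series G (of_nat (Suc q))) m"
      unfolding chromatic_series_def by (simp only: mfps_coeff_Abs poly_gen_chromatic_poly[OF assms])
    finally show "mfps_coeff (chromatic_series G (of_nat (Suc q))) m =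
        mfps_coeff (independence_series G ^ Suc q) m" by simp
  qed
qed

lemma is_polynomial_chromatic_series: "is_polynomial (\<lambda>z. mfps_coeff (chromatic_series G z) m)"
  unfolding chromatic_series_def by (cases "Poly_Mapping.keys m \<subseteq> pverts G") auto

text \<open>A coefficient of the product is a finite sum over \<open>splits m\<close>, hence
  polynomial in z; at natural z the claim is the law of exponents.\<close>

lemma independence_series_power_mult_chromatic_series:
  assumes "pair_graph G"
  shows "independence_series G ^ q * chromatic_series G z = chromatic_series G (of_nat q + z)"
proof (rule mfps_eqI)
  fix m
  show "mfps_coeff (independence_series G ^ q * chromatic_series G z) m =
      mfps_coeff (chromatic_series G (of_nat q + z)) m"
  proof (rule is_polynomial_eqI[where N = 0 and
        f = "\<lambda>z. mfps_coeff (independence_series G ^ q * chromatic_series G z) m"])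
    show "is_polynomial (\<lambda>z. mfps_coeff (independence_series G ^ q * chromatic_series G z) m)"
      unfolding mfps_coeff_mult case_prod_unfold
      by (intro is_polynomial_sum is_polynomial_mult is_polynomial_const is_polynomial_chromatic_series)
    show "is_polynomial (\<lambda>z. mfps_coeff (chromatic_series G (of_nat q + z)) m)"
      by (rule is_polynomial_compose[OF is_polynomial_chromatic_series]) auto
    fix r :: nat
    have "chromatic_series G (of_nat q + of_nat r) = independence_series G ^ (q + r)"
      using chromatic_series_of_nat[OF assms, of "q + r"] by simp
    thus "mfps_coeff (independence_series G ^ q * chromatic_series G (of_nat r)) m =
        mfps_coeff (chromatic_series G (of_nat q + of_nat r)) m"
      by (simp add: chromatic_series_of_nat[OF assms] power_add)
  qed
qed

lemma mfps_coeff_independence_series_0: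
  fixes G :: "'i pair_pre_digraph"
  assumes "pair_graph G"
  shows "mfps_coeff (independence_series G) 0 = 1"
proof -
  interpret pair_graph G by (rule assms)
  \<comment> \<open>The factor 1 makes the product formula applicable; at exponent 0 only the empty
    set survives.\<close>
  have "mfps_coeff (independence_series G * 1) 0 = (\<Sum>S\<in>{{} :: 'i set}. 1)"
    unfolding mfps_coeff_independence_series_mult[OF assms]
  proof (rule sum.mono_neutral_cong_right)
    show "finite (independent_sets G)"
      by (rule finite_subset[of _ "Pow (pverts G)"]) (auto simp: independent_sets_def)
  qed (auto simp: independent_sets_def exponent_def mfps_coeff_one)
  thus ?thesis by simp
qed

lemma independence_series_powi_minus:
  assumes "pair_graph G"
  shows "independence_series G powi (- int q) = chromatic_series G (- of_nat q)"
proof -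
  let ?f = "independence_series G"
  have inv: "?f * inverse ?f = 1"
    by (rule mfps_right_inverse) (simp add: mfps_coeff_independence_series_0[OF assms])
  \<comment> \<open>With z = -q the right-hand side is \<open>chromatic_series G 0\<close>, the
    power with exponent 0.\<close>
  have "?f ^ q * chromatic_series G (- of_nat q) = 1"
    using independence_series_power_mult_chromatic_series[OF assms, of q "- of_nat q"]
      chromatic_series_of_nat[OF assms, of 0] by simp
  hence "inverse ?f ^ q = inverse ?f ^ q * (?f ^ q * chromatic_series G (- of_nat q))" by simp
  also have "\<dots> = (?f * inverse ?f) ^ q * chromatic_series G (- of_nat q)"
    by (simp only: power_mult_distrib mult_ac)
  finally show ?thesis by (auto simp: inv power_int_def)
qed

lemma mfps_coeff_independence_series_powi_minus:
  assumes "pair_graph G"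
  shows "mfps_coeff (independence_series G powi (- int q)) (exponent (pverts G) m) =
    poly (gen_chromatic_poly G m) (- of_nat q)"
proof -
  interpret pair_graph G by (rule assms)
  have l: "Poly_Mapping.lookup (exponent (pverts G) m) i = (if i \<in> pverts G then m i else 0)" for i
    by (rule lookup_exponent[OF pair_finite_verts])
  have "gen_chromatic_poly G (Poly_Mapping.lookup (exponent (pverts G) m)) = gen_chromatic_poly G m"
    by (rule gen_chromatic_poly_cong) (simp add: l)
  moreover have "Poly_Mapping.keys (exponent (pverts G) m) \<subseteq> pverts G"
    by (auto simp: in_keys_iff l split: if_splits)
  ultimately show ?thesis
    by (simp add: independence_series_powi_minus[OF assms] chromatic_series_def)
qed

section \<open>Closed formula, and its value at -1\<close>

section \<open>The formula for the cycle\<close>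

lemma ffact_add: "ffact z (a + b) = ffact z a * ffact (z - of_nat a) b"
  unfolding ffact_def by (induction b) (simp_all add: algebra_simps)

lemma ffact_of_nat:
  assumes "k \<le> m"
  shows "ffact (of_nat m :: rat) k = fact m / fact (m - k)"
proof -
  have "ffact (of_nat m :: rat) k = fact k * (of_nat m gchoose k)"
    by (simp add: gbinomial_ffact)
  also have "\<dots> = fact k * of_nat (m choose k)"
    by (simp only: binomial_gbinomial)
  also have "\<dots> = fact m / fact (m - k)"
    using assms by (simp add: binomial_fact)
  finally show ?thesis .
qed

lemma bij_betw_cycle_successor:
  assumes "n \<ge> 1"
  shows "bij_betw (\<lambda>i. i mod n + 1) {1..n} {1..n :: nat}"
proof -
  have "inj_on (\<lambda>i. i mod n + 1) {1..n}"
  proof (rule inj_onI)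
    fix i j assume "i \<in> {1..n}" "j \<in> {1..n}" "i mod n + 1 = j mod n + 1"
    thus "i = j" by (cases "i = n"; cases "j = n") auto
  qed
  moreover have "(\<lambda>i. i mod n + 1) ` {1..n} \<subseteq> {1..n}"
    using assms by (auto simp: Suc_le_eq)
  ultimately show ?thesis
    by (simp add: bij_betw_def endo_inj_surj)
qed

text \<open>Clears the denominators, giving a form that is polynomial in z. Termwise, the quotient
  of falling factorials at m_i + m_(i+1) and m_i + k is the falling factorial of z - m_i - k of
  length m_(i+1) - k, and (m_i)_(k) / m_i! = 1 / (m_i - k)!.\<close>

lemma cycle_formula_eq:
  fixes z :: rat and m :: "nat \<Rightarrow> nat"
  assumes "n \<ge> 1" "\<And>j. ffact z j \<noteq> 0"
  shows "1 / (\<Prod>i=1..n. fact (m i)) * (\<Prod>i=1..n. ffact z (m i + m (i mod n + 1)))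
      * (\<Sum>k=0..Min (m ` {1..n}). (- 1) ^ (k * n) * gbinomial_diff z k
           * (\<Prod>i=1..n. ffact (of_nat (m i)) k / ffact z (m i + k))) =
    (\<Sum>k\<le>Min (m ` {1..n}). (- 1) ^ (k * n) * gbinomial_diff z k
       * (\<Prod>i=1..n. (z - of_nat (m i + k)) gchoose (m (i mod n + 1) - k)))"
  unfolding sum_distrib_left atLeast0AtMost
proof (intro sum.cong refl)
  fix k assume "k \<in> {..Min (m ` {1..n})}"
  hence k: "k \<le> m i" if "i \<in> {1..n}" for i
    using that assms(1) by auto
  let ?s = "\<lambda>i. i mod n + 1"
  have s: "?s i \<in> {1..n}" if "i \<in> {1..n}" for i
    using bij_betw_cycle_successor[OF assms(1)] that by (auto simp: bij_betw_def)
  have A: "1 / (\<Prod>i=1..n. fact (m i)) * (\<Prod>i=1..n. ffact (of_nat (m i)) k) =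
      (\<Prod>i=1..n. 1 / fact (m (?s i) - k) :: rat)"
  proof -
    have "1 / (\<Prod>i=1..n. fact (m i)) * (\<Prod>i=1..n. ffact (of_nat (m i)) k) =
        (\<Prod>i=1..n. ffact (of_nat (m i)) k / fact (m i) :: rat)"
      by (simp add: prod_dividef)
    also have "\<dots> = (\<Prod>i=1..n. 1 / fact (m i - k))"
      using k by (intro prod.cong refl) (simp add: ffact_of_nat)
    \<comment> \<open>The cyclic shift attaches each factorial to the predecessor of its vertex,
      where it completes a binomial coefficient.\<close>
    also have "\<dots> = (\<Prod>i=1..n. 1 / fact (m (?s i) - k))"
      by (rule prod.reindex_bij_betw[OF bij_betw_cycle_successor[OF assms(1)],
          of "\<lambda>i. 1 / fact (m i - k)", symmetric])
    finally show ?thesis .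
  qed
  have B: "ffact z (m i + m (?s i)) =
      ffact z (m i + k) * (fact (m (?s i) - k) * ((z - of_nat (m i + k)) gchoose (m (?s i) - k)))"
    if "i \<in> {1..n}" for i
    using ffact_add[of z "m i + k" "m (?s i) - k"] k[OF s[OF that]] by (simp add: gbinomial_ffact)
  have "1 / (\<Prod>i=1..n. fact (m i)) * (\<Prod>i=1..n. ffact z (m i + m (?s i)))
      * ((- 1) ^ (k * n) * gbinomial_diff z k * (\<Prod>i=1..n. ffact (of_nat (m i)) k / ffact z (m i + k))) =
    (- 1) ^ (k * n) * gbinomial_diff z k *
      ((1 / (\<Prod>i=1..n. fact (m i)) * (\<Prod>i=1..n. ffact (of_nat (m i)) k)) *
       ((\<Prod>i=1..n. ffact z (m i + m (?s i))) / (\<Prod>i=1..n. ffact z (m i + k))))"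
    by (simp add: prod_dividef)
  also have "\<dots> = (- 1) ^ (k * n) * gbinomial_diff z k *
      (\<Prod>i=1..n. 1 / fact (m (?s i) - k) * (ffact z (m i + m (?s i)) / ffact z (m i + k)))"
    unfolding A by (simp only: prod.distrib prod_dividef)
  also have "\<dots> = (- 1) ^ (k * n) * gbinomial_diff z k *
      (\<Prod>i=1..n. (z - of_nat (m i + k)) gchoose (m (?s i) - k))"
  proof -
    have "1 / fact (m (?s i) - k) * (ffact z (m i + m (?s i)) / ffact z (m i + k)) =
        (z - of_nat (m i + k)) gchoose (m (?s i) - k)" if "i \<in> {1..n}" for i
      unfolding B[OF that] using assms(2) by (simp del: of_nat_add)
    thus ?thesis by (simp only: cong: prod.cong)
  qed
  finally show "1 / (\<Prod>i=1..n. fact (m i)) * (\<Prod>i=1..n. ffact z (m i + m (?s i)))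
      * ((- 1) ^ (k * n) * gbinomial_diff z k * (\<Prod>i=1..n. ffact (of_nat (m i)) k / ffact z (m i + k))) =
    (- 1) ^ (k * n) * gbinomial_diff z k *
      (\<Prod>i=1..n. (z - of_nat (m i + k)) gchoose (m (?s i) - k))" .
qed

lemma gbinomial_minus_one: "(- 1 :: rat) gchoose k = (- 1) ^ k"
  using gbinomial_minus[of "1 :: rat" k] binomial_gbinomial[of k k, where 'a = rat] by simp

text \<open>Consecutive binomials of -1 have opposite signs, so for k > 0 the difference
  doubles.\<close>

lemma gbinomial_diff_minus_one:
  "gbinomial_diff (- 1 :: rat) k = (if k = 0 then 1 else 2 * (- 1) ^ k)"
  by (cases k) (auto simp: gbinomial_diff_def gbinomial_minus_one)

lemma sum_symmetric_interval:
  fixes g :: "int \<Rightarrow> 'a :: comm_monoid_add"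
  shows "(\<Sum>j=- int a..int a. g j) = (\<Sum>k\<le>a. if k = 0 then g 0 else g (int k) + g (- int k))"
proof (induction a)
  case (Suc a)
  have "{- int (Suc a)..int (Suc a)} = insert (int (Suc a)) (insert (- int (Suc a)) {- int a..int a})"
    by auto
  thus ?case using Suc by (simp add: add_ac)
qed simp

text \<open>Upper negation produces \<open>(2 * a) choose (a - k)\<close>, and the signs combine to
  (-1)^(na). The factor 2 for k > 0 accounts for the two indices k and -k, whose binomials agree by
  symmetry.\<close>

lemma cycle_formula_minus_one:
  "(\<Sum>k\<le>a. (- 1) ^ (k * n) * gbinomial_diff (- 1) k
       * (\<Prod>i=1..n. ((- 1 :: rat) - of_nat (a + k)) gchoose (a - k))) =
   (- 1) ^ (n * a) * (\<Sum>k=- int a..int a. (- 1) powi k * of_nat ((2 * a) choose nat (int a + k)) ^ n)"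
  unfolding sum_symmetric_interval sum_distrib_left
proof (intro sum.cong refl)
  fix k assume "k \<in> {..a}"
  hence k: "k \<le> a" by simp
  have gb: "((- 1 :: rat) - of_nat (a + k)) gchoose (a - k) = (- 1) ^ (a - k) * of_nat ((2 * a) choose (a - k))"
  proof -
    have "of_nat (a - k) - ((- 1 :: rat) - of_nat (a + k)) - 1 = of_nat (2 * a)"
      using k by (simp add: of_nat_diff)
    thus ?thesis
      by (subst gbinomial_negated_upper) (simp only: binomial_gbinomial)
  qed
  have sign: "(- 1 :: rat) ^ (k * n) * ((- 1) ^ (a - k)) ^ n = (- 1) ^ (n * a)"
    using k by (simp flip: power_mult power_add add: algebra_simps)
  have sym: "(2 * a) choose (a + k) = (2 * a) choose (a - k)"
    using k binomial_symmetric[of "a + k" "2 * a"] by simp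
  have nat: "nat (int a + int k) = a + k" "nat (int a - int k) = a - k"
    using k by auto
  have powi: "(- 1 :: rat) powi (- int k) = (- 1) ^ k"
    by (simp add: power_int_minus flip: power_inverse)
  have "(- 1) ^ (k * n) * gbinomial_diff (- 1) k
       * (\<Prod>i=1..n. ((- 1 :: rat) - of_nat (a + k)) gchoose (a - k)) =
      ((- 1) ^ (k * n) * ((- 1) ^ (a - k)) ^ n) * (gbinomial_diff (- 1) k * of_nat ((2 * a) choose (a - k)) ^ n)"
    unfolding gb by (simp add: power_mult_distrib)
  also have "\<dots> = (- 1) ^ (n * a) * (if k = 0 then (- 1) powi 0 * of_nat ((2 * a) choose nat (int a + 0)) ^ n
         else (- 1) powi int k * of_nat ((2 * a) choose nat (int a + int k)) ^ n
           + (- 1) powi (- int k) * of_nat ((2 * a) choose nat (int a + - int k)) ^ n)"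
    unfolding sign by (simp add: gbinomial_diff_minus_one nat sym powi)
  finally show "(- 1) ^ (k * n) * gbinomial_diff (- 1) k
       * (\<Prod>i=1..n. ((- 1 :: rat) - of_nat (a + k)) gchoose (a - k)) =
      (- 1) ^ (n * a) * (if k = 0 then (- 1) powi 0 * of_nat ((2 * a) choose nat (int a + 0)) ^ n
         else (- 1) powi int k * of_nat ((2 * a) choose nat (int a + int k)) ^ n
           + (- 1) powi (- int k) * of_nat ((2 * a) choose nat (int a + - int k)) ^ n)" .
qed

lemma poly_gen_chromatic_poly_cycle:
  assumes "n \<ge> 3"
  shows "poly (gen_chromatic_poly (cycle_graph n) m) z =
    (\<Sum>k\<le>Min (m ` {1..n}). (- 1) ^ (k * n) * gbinomial_diff z k
       * (\<Prod>i=1..n. (z - of_nat (m i + k)) gchoose (m (i mod n + 1) - k)))"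
proof -
  let ?M = "Min (m ` {1..n})" and ?s = "\<lambda>i. i mod n + 1"
  let ?g = "\<lambda>z. \<Sum>k\<le>?M. (- 1) ^ (k * n) * gbinomial_diff z k
      * (\<Prod>i=1..n. (z - of_nat (m i + k)) gchoose (m (?s i) - k))"
  have "is_polynomial ?g"
    by (intro is_polynomial_sum is_polynomial_mult is_polynomial_const is_polynomial_gbinomial_diff
        is_polynomial_prod is_polynomial_gbinomial is_polynomial_diff is_polynomial_ident)
  \<comment> \<open>This bound gives \<open>2 * m 1 \<le> r\<close> for the trace formula and
    \<open>m i + k \<le> r\<close>, so no natural subtraction truncates.\<close>
  moreover have "poly (gen_chromatic_poly (cycle_graph n) m) (of_nat r) = ?g (of_nat r)"
    if r: "2 * Max (m ` {1..n}) \<le> r" for r :: nat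
  proof -
    have range: "m i \<in> m ` {1..n}" if "i \<in> {1..n}" for i
      using that by blast
    have big: "2 * m i \<le> r" if "i \<in> {1..n}" for i
      using r Max_ge[OF _ range[OF that]] by simp
    have min: "?M \<le> m i" if "i \<in> {1..n}" for i
      using Min_le[OF _ range[OF that]] by simp
    define w where "w = (\<lambda>k i. if k \<le> m (?s i)
      then (- 1) ^ k * of_nat ((r - m i - k) choose (m (?s i) - k)) else (0 :: rat))"
    have "poly (gen_chromatic_poly (cycle_graph n) m) (of_nat r) =
        (\<Sum>k\<le>m 1. gbinomial_diff (of_nat r) k * (\<Prod>i=1..n. w k i))"
      unfolding poly_gen_chromatic_poly[OF pair_graph_cycle_graph[OF assms]] w_def
      using assms big[of 1] by (intro card_multicolorings_cycle) auto
    also have "\<dots> = (\<Sum>k\<le>?M. gbinomial_diff (of_nat r) k * (\<Prod>i=1..n. w k i))"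
    proof (rule sum.mono_neutral_right)
      show "{..?M} \<subseteq> {..m 1}" using min[of 1] assms by auto
      \<comment> \<open>The vertex preceding one of minimal \<open>m\<close> contributes a zero
        factor, which shortens the trace sum from \<open>m 1\<close> to the minimum.\<close>
      have "(\<Prod>i=1..n. w k i) = 0" if "k > ?M" for k
      proof -
        have "?M \<in> m ` {1..n}" using assms by (intro Min_in) auto
        moreover have "{1..n} = ?s ` {1..n}"
          using bij_betw_cycle_successor[of n] assms by (simp add: bij_betw_def)
        ultimately obtain i where i: "i \<in> {1..n}" "m (?s i) = ?M"
          by (metis (no_types, lifting) imageE)
        have "w k i = 0"
          unfolding w_def i(2) using that by (simp only: not_le[symmetric] if_False)
        thus ?thesis using i(1) by (intro prod_zero, simp, blast)
      qed
      thus "\<forall>k\<in>{..m 1} - {..?M}. gbinomial_diff (of_nat r) k * (\<Prod>i=1..n. w k i) = 0" by auto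
    qed simp
    also have "\<dots> = (\<Sum>k\<le>?M. (- 1) ^ (k * n) * gbinomial_diff (of_nat r) k
        * (\<Prod>i=1..n. (of_nat r - of_nat (m i + k)) gchoose (m (?s i) - k)))"
    proof (intro sum.cong refl)
      fix k assume k: "k \<in> {..?M}"
      have "w k i = (- 1) ^ k * ((of_nat r - of_nat (m i + k)) gchoose (m (?s i) - k))"
        if i: "i \<in> {1..n}" for i
      proof -
        have "?s i \<in> {1..n}"
          using bij_betw_cycle_successor[of n] assms i by (auto simp: bij_betw_def)
        moreover have "k \<le> ?M" using k by (simp only: atMost_iff)
        ultimately have "k \<le> m i" "k \<le> m (?s i)" using min i order_trans by blast+
        moreover from this have "of_nat (r - m i - k) = (of_nat r - of_nat (m i + k) :: rat)"
          using big[OF i] by (simp add: of_nat_diff)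
        ultimately show ?thesis by (simp only: w_def if_True binomial_gbinomial)
      qed
      hence "(\<Prod>i=1..n. w k i) =
          (\<Prod>i=1..n. (- 1) ^ k * ((of_nat r - of_nat (m i + k)) gchoose (m (?s i) - k)))"
        by (rule prod.cong[OF refl])
      also have "\<dots> = (- 1) ^ (k * n) * (\<Prod>i=1..n. (of_nat r - of_nat (m i + k)) gchoose (m (?s i) - k))"
        by (simp add: prod.distrib power_mult del: of_nat_add)
      finally show "gbinomial_diff (of_nat r) k * (\<Prod>i=1..n. w k i) =
          (- 1) ^ (k * n) * gbinomial_diff (of_nat r) k
            * (\<Prod>i=1..n. (of_nat r - of_nat (m i + k)) gchoose (m (?s i) - k))"
        by (simp only: mult_ac)
    qed
    finally show ?thesis .
  qed
  ultimately show ?thesis by (rule is_polynomial_eqI[OF is_polynomial_poly])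
qed

theorem corollary3:
  fixes n q :: nat
  assumes "n \<ge> 3" and "q \<ge> 1"
  shows "(\<forall>m :: nat \<Rightarrow> nat.
            mfps_coeff (independence_series (cycle_graph n) powi (- int q)) (exponent {1..n} m)
              = poly (gen_chromatic_poly (cycle_graph n) m) (- of_nat q)
          \<and> poly (gen_chromatic_poly (cycle_graph n) m) (- of_nat q)
              = 1 / (\<Prod>i=1..n. fact (m i))
                * (\<Prod>i=1..n. ffact (- of_nat q) (m i + m (i mod n + 1)))
                * (\<Sum>k=0..Min (m ` {1..n}).
                     (- 1) ^ (k * n) * gbinomial_diff (- of_nat q) k
                     * (\<Prod>i=1..n. ffact (of_nat (m i)) k / ffact (- of_nat q) (m i + k))))
       \<and> (\<forall>a :: nat.
            mfps_coeff (independence_series (cycle_graph n) powi (- 1)) (exponent {1..n} (\<lambda>_. a))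
              = (- 1) ^ (n * a)
                * (\<Sum>k=- int a..int a.
                     (- 1) powi k * of_nat ((2 * a) choose nat (int a + k)) ^ n))"
proof (intro conjI allI)
  fix m :: "nat \<Rightarrow> nat"
  have coeff: "mfps_coeff (independence_series (cycle_graph n) powi (- int q')) (exponent {1..n} m)
      = poly (gen_chromatic_poly (cycle_graph n) m) (- of_nat q')" for m :: "nat \<Rightarrow> nat" and q'
    using mfps_coeff_independence_series_powi_minus[OF pair_graph_cycle_graph[OF assms(1)], of q' m]
    by (simp add: cycle_graph_def)
  show "mfps_coeff (independence_series (cycle_graph n) powi (- int q)) (exponent {1..n} m)
      = poly (gen_chromatic_poly (cycle_graph n) m) (- of_nat q)"
    by (rule coeff)
  \<comment> \<open>Since q >= 1, every factor -q - i is negative; this justifies the division by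
    falling factorials.\<close>
  have "ffact (- of_nat q :: rat) j \<noteq> 0" for j
  proof -
    have "- of_nat q - of_nat i < (0 :: rat)" for i
      using assms(2) by (simp add: add_pos_nonneg)
    thus ?thesis by (auto simp: ffact_def less_imp_neq)
  qed
  thus "poly (gen_chromatic_poly (cycle_graph n) m) (- of_nat q)
      = 1 / (\<Prod>i=1..n. fact (m i))
        * (\<Prod>i=1..n. ffact (- of_nat q) (m i + m (i mod n + 1)))
        * (\<Sum>k=0..Min (m ` {1..n}).
             (- 1) ^ (k * n) * gbinomial_diff (- of_nat q) k
             * (\<Prod>i=1..n. ffact (of_nat (m i)) k / ffact (- of_nat q) (m i + k)))"
    using assms(1) unfolding poly_gen_chromatic_poly_cycle[OF assms(1)]
    by (intro cycle_formula_eq[symmetric]) auto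
  fix a :: nat
  \<comment> \<open>The case q = 1 starts from the form without denominators.\<close>
  have "(\<lambda>_. a) ` {1..n} = {a}" using assms(1) by (simp add: image_constant_conv)
  hence "poly (gen_chromatic_poly (cycle_graph n) (\<lambda>_. a)) (- of_nat 1) =
      (\<Sum>k\<le>a. (- 1) ^ (k * n) * gbinomial_diff (- 1) k
         * (\<Prod>i=1..n. ((- 1) - of_nat (a + k)) gchoose (a - k)))"
    unfolding poly_gen_chromatic_poly_cycle[OF assms(1)] by (simp only: Min_singleton of_nat_1)
  also have "\<dots> = (- 1) ^ (n * a)
      * (\<Sum>k=- int a..int a. (- 1) powi k * of_nat ((2 * a) choose nat (int a + k)) ^ n)"
    by (rule cycle_formula_minus_one)
  finally show "mfps_coeff (independence_series (cycle_graph n) powi (- 1)) (exponent {1..n} (\<lambda>_. a))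
      = (- 1) ^ (n * a)
        * (\<Sum>k=- int a..int a. (- 1) powi k * of_nat ((2 * a) choose nat (int a + k)) ^ n)"
    using coeff[of 1 "\<lambda>_. a"] by simp
qed

end
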